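(* Let $\mathfrak g$ be a finite-dimensional complex reductive Lie algebra with associated complex algebraic group $G$, Cartan subalgebra $\mathfrak h$, Weyl group $W$ and fundamental degrees $d_1,\dots,d_l$. For $(p,r)\in\mathbb Z^2$ let $\mathfrak a_{p,r}=\mathbb C.u\oplus\mathbb C.v$ be the homologically graded abelian Lie algebra with $u$ in degree $p$ and $v$ in degree $r$, equipped with the $\mathbb Z^2$-weight grading in which $u$ has weight $(1,0)$ and $v$ has weight $(0,1)$. (i) The weighted Euler characteristic of $\mathrm{DRep}_{\mathfrak g}(\mathfrak a_{p,r})^G$ depends only on the parities of $p$ and $r$. (ii) If either the derived Harish-Chandra map $$\Phi_{\mathfrak g}:\mathrm{DRep}_{\mathfrak g}(\mathfrak a)^G\to\mathbf{Sym}_{\mathbb C}\big(\mathfrak h^*\otimes\overline{\mathbf{Sym}^c}(\mathfrak a[1])[-1]\big)^W$$ or the Drinfeld trace map $$\mathbf{Sym}_{\mathbb C}[\mathrm{Tr}_{\mathfrak g}(\mathfrak a)]:\mathbf{Sym}_{\mathbb C}[\oplus_{i=1}^l\mathbb L\lambda^{(d_i)}(\mathfrak a)]\to\mathrm{DRep}_{\mathfrak g}(\mathfrak a)^G$$ is a quasi-isomorphism for $\mathfrak a=\mathfrak a_{p,r}$, then the same map is a quasi-isomorphism for $\mathfrak a=\mathfrak a_{p',r'}$ whenever $p,p'$ have the same parity and $r,r'$ have the same parity.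
   Context: DG objects are homologically graded; $V[i]_j=V_{j-i}$; $\mathbf{Sym}$ (resp. $\mathbf{Sym}^c$) is the graded symmetric algebra (resp. coalgebra), and $\overline{\mathbf{Sym}^c}(V)$ is the coaugmentation coideal $\bigoplus_{i\ge1}\mathrm{Sym}^i(V)$. For a $\mathbb Z^2$-weight graded complex $V$ with finite-dimensional weight components, the weighted Euler characteristic is $\sum_{a,b}\sum_i(-1)^i\dim (V_i)_{(a,b)}\,q^at^b$. Let $\mathfrak L\xrightarrow{\sim}\mathfrak a$ be the cofibrant resolution of DG Lie algebras $\mathfrak L=\boldsymbol\Omega_{\mathtt{Comm}}(C)$, $C=\mathbf{Sym}^c(\mathfrak a[1])$: the free graded Lie algebra on $\bar C[-1]$ with differential induced by the coproduct of $C$. $\mathfrak L_{\mathfrak g}$ is the commutative DG algebra (co)representing $B\mapsto\mathrm{Hom}_{\mathrm{DGLA}}(\mathfrak L,\mathfrak g\otimes B)$, with universal representation $\pi_{\mathfrak g}:\mathfrak L\to\mathfrak g\otimes\mathfrak L_{\mathfrak g}$; $\mathrm{DRep}_{\mathfrak g}(\mathfrak a)^G:=\mathfrak L_{\mathfrak g}^G=\mathfrak L_{\mathfrak g}^{\mathrm{ad}\,\mathfrak g}$. As a graded algebra $\mathfrak L_{\mathfrak g}=\mathbf{Sym}(\mathfrak g^*\otimes\bar C[-1])$. $\Phi_{\mathfrak g}$ is the restriction to $G$-invariants of the algebra map induced by the projection $\mathfrak g^*\twoheadrightarrow\mathfrak h^*$ dual to $\mathfrak h\hookrightarrow\mathfrak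 g$; its image lies in $W$-invariants, and its target has zero differential. Drinfeld trace: $\lambda^{(d)}(\mathfrak b):=\mathrm{Sym}^d(\mathfrak b)/[\mathfrak b,\mathrm{Sym}^d(\mathfrak b)]$ and $\mathbb L\lambda^{(d)}(\mathfrak a):=\lambda^{(d)}(\mathfrak L)$. The composite $\lambda^{(d)}(\mathfrak L)\to\lambda^{(d)}(\mathfrak g\otimes\mathfrak L_{\mathfrak g})\to\lambda^{(d)}(\mathfrak g)\otimes\mathfrak L_{\mathfrak g}$ (first map $\lambda^{(d)}(\pi_{\mathfrak g})$, second multiplying the $\mathfrak L_{\mathfrak g}$-factors) has image in $\lambda^{(d)}(\mathfrak g)\otimes\mathfrak L_{\mathfrak g}^{\mathrm{ad}\,\mathfrak g}$; pairing with $P\in\mathrm{Sym}^d(\mathfrak g^* )^{\mathrm{ad}\,\mathfrak g}$ gives $\mathrm{Tr}_{\mathfrak g}^P:\lambda^{(d)}(\mathfrak L)\to\mathfrak L_{\mathfrak g}^{\mathrm{ad}\,\mathfrak g}$. Fix homogeneous algebraically independent generators $P_1,\dots,P_l$ of $\mathrm{Sym}(\mathfrak g^* )^{\mathrm{ad}\,\mathfrak g}$, $\deg P_i=d_i$; $\mathbf{Sym}[\mathrm{Tr}_{\mathfrak g}(\mathfrak a)]$ is the DG algebra homomorphism extending $\oplus_i\mathrm{Tr}^{P_i}_{\mathfrak g}$. *)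

theory Defs
  imports Complex_Main "HOL-Library.Poly_Mapping" "HOL-Library.Multiset" "HOL-Library.Product_Plus"
begin

section \<open>Vector spaces by generators and relations\<close>

text \<open>
  The complex vector space with basis \<open>'k\<close> is the type \<open>'k \<Rightarrow>\<^sub>0 complex\<close>. All graded spaces below are
  given by homogeneous generators (a subset \<open>X\<close> of a type \<open>'k\<close> with a degree function) and relations
  (a subspace of the span of \<open>X\<close>): the space meant is the span of \<open>X\<close> modulo the relations.
\<close>

type_synonym 'k fv = "'k \<Rightarrow>\<^sub>0 complex"

abbreviation bas :: "'k \<Rightarrow> 'k fv" where
  "bas k \<equiv> Poly_Mapping.single k 1"

definition scl :: "complex \<Rightarrow> 'k fv \<Rightarrow> 'k fv" where
  "scl c x = Poly_Mapping.map ((*) c) x"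

lemma lookup_scl [simp]: "Poly_Mapping.lookup (scl c x) k = c * Poly_Mapping.lookup x k"
  by (simp add: scl_def Poly_Mapping.map.rep_eq)
    (metis mult_zero_right when_def)

global_interpretation fv: vector_space scl
  by unfold_locales (auto intro!: poly_mapping_eqI simp: lookup_add algebra_simps)

definition lin :: "('k \<Rightarrow> 'j fv) \<Rightarrow> 'k fv \<Rightarrow> 'j fv" where
  "lin f x = (\<Sum>k\<in>Poly_Mapping.keys x. scl (Poly_Mapping.lookup x k) (f k))"

lemma scl_add_left: "scl (a + b) x = scl a x + scl b x"
  by (fact fv.scale_left_distrib)

lemma scl_add_right: "scl a (x + y) = scl a x + scl a y"
  by (fact fv.scale_right_distrib)

lemma lin_superset:
  assumes "finite S" "Poly_Mapping.keys x \<subseteq> S"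
  shows "lin f x = (\<Sum>k\<in>S. scl (Poly_Mapping.lookup x k) (f k))"
  unfolding lin_def by (rule sum.mono_neutral_left) (use assms in \<open>auto simp: in_keys_iff\<close>)

lemma lin_add [simp]: "lin f (x + y) = lin f x + lin f y"
proof -
  let ?S = "Poly_Mapping.keys x \<union> Poly_Mapping.keys y"
  have "Poly_Mapping.keys (x + y) \<subseteq> ?S" by (rule Poly_Mapping.keys_add)
  then show ?thesis
    by (simp add: lin_superset[of ?S] lookup_add scl_add_left sum.distrib)
qed

lemma lin_scl [simp]: "lin f (scl c x) = scl c (lin f x)"
proof -
  have "Poly_Mapping.keys (scl c x) \<subseteq> Poly_Mapping.keys x" by (auto simp: in_keys_iff)
  then show ?thesis
    by (simp add: lin_superset[of "Poly_Mapping.keys x"] fv.scale_sum_right)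
qed

lemma lin_zero [simp]: "lin f 0 = 0"
  by (simp add: lin_def)

lemma lin_sum: "lin f (\<Sum>i\<in>A. g i) = (\<Sum>i\<in>A. lin f (g i))"
  by (induction A rule: infinite_finite_induct) auto

lemma lin_bas [simp]: "lin f (bas k) = f k"
  by (simp add: lin_def)

lemma fv_induct [case_names zero add scl bas]:
  assumes "P 0" "\<And>x y. P x \<Longrightarrow> P y \<Longrightarrow> P (x + y)" "\<And>c x. P x \<Longrightarrow> P (scl c x)"
    and "\<And>k. k \<in> Poly_Mapping.keys z \<Longrightarrow> P (bas k)"
  shows "P z"
proof -
  have z: "z = (\<Sum>k\<in>Poly_Mapping.keys z. scl (Poly_Mapping.lookup z k) (bas k))"
    by (rule poly_mapping_eqI)
      (auto simp: lookup_sum lookup_single when_def in_keys_iff if_distrib cong: if_cong)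
  have "P (\<Sum>k\<in>S. scl (Poly_Mapping.lookup z k) (bas k))" if "S \<subseteq> Poly_Mapping.keys z" for S
    using finite_subset[OF that finite_keys] that by (induction S) (auto intro: assms)
  from this[OF subset_refl] show ?thesis using z by simp
qed

lemma lin_add_fun: "lin (\<lambda>k. f k + g k) x = lin f x + lin g x"
  by (simp add: lin_def scl_add_right sum.distrib)

lemma lin_scl_fun: "lin (\<lambda>k. scl c (f k)) x = scl c (lin f x)"
  by (simp add: lin_def fv.scale_sum_right mult.commute)

lemma lin_sum_fun: "lin (\<lambda>k. \<Sum>i\<in>A. f i k) x = (\<Sum>i\<in>A. lin (f i) x)"
  by (simp add: lin_def fv.scale_sum_right sum.swap[of _ A])

text \<open>The product of the free associative algebra on \<open>'x\<close>, whose basis are the words in \<open>'x\<close>.\<close>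

definition mul :: "'x list fv \<Rightarrow> 'x list fv \<Rightarrow> 'x list fv" where
  "mul x y = lin (\<lambda>v. lin (\<lambda>w. bas (v @ w)) y) x"

lemma mul_simps [simp]:
  "mul (x + y) z = mul x z + mul y z" "mul x (y + z) = mul x y + mul x z"
  "mul (scl c x) z = scl c (mul x z)" "mul x (scl c y) = scl c (mul x y)"
  "mul 0 x = 0" "mul x 0 = 0" "mul (bas v) (bas w) = bas (v @ w)"
  by (simp_all add: mul_def lin_add_fun lin_scl_fun) (simp_all add: lin_def)

lemma mul_sum: "mul (\<Sum>i\<in>A. f i) z = (\<Sum>i\<in>A. mul (f i) z)" "mul z (\<Sum>i\<in>A. f i) = (\<Sum>i\<in>A. mul z (f i))"
  by (induction A rule: infinite_finite_induct; simp)+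

lemma mul_assoc: "mul (mul x y) z = mul x (mul y z)"
proof (induction x rule: fv_induct)
  case (bas u)
  show ?case
  proof (induction y rule: fv_induct)
    case (bas v)
    show ?case by (induction z rule: fv_induct) auto
  qed auto
qed auto

primrec alg_ext :: "('x \<Rightarrow> 'y list fv) \<Rightarrow> 'x list \<Rightarrow> 'y list fv" where
  "alg_ext f [] = bas []"
| "alg_ext f (x # w) = mul (f x) (alg_ext f w)"

definition ksgn :: "int \<Rightarrow> int \<Rightarrow> complex" where
  "ksgn m n = (if odd m \<and> odd n then - 1 else 1)"

definition wsum :: "('x \<Rightarrow> 'a::monoid_add) \<Rightarrow> 'x list \<Rightarrow> 'a" where
  "wsum f w = (\<Sum>x\<leftarrow>w. f x)"

text \<open>\<open>der e deg D\<close> is the derivation of degree \<open>e\<close> with values \<open>D\<close> on the letters.\<close>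

primrec der :: "int \<Rightarrow> ('x \<Rightarrow> int) \<Rightarrow> ('x \<Rightarrow> 'x list fv) \<Rightarrow> 'x list \<Rightarrow> 'x list fv" where
  "der e deg D [] = 0"
| "der e deg D (x # w) = mul (D x) (bas w) + scl (ksgn e (deg x)) (mul (bas [x]) (der e deg D w))"

lemma mul_one [simp]: "mul x (bas []) = x" "mul (bas []) x = x"
  by (induction x rule: fv_induct; simp)+

lemma keys_sumD: "v \<in> Poly_Mapping.keys (\<Sum>a\<in>A. f a) \<Longrightarrow> \<exists>a\<in>A. v \<in> Poly_Mapping.keys (f a)"
  by (auto simp: in_keys_iff lookup_sum elim: sum.not_neutral_contains_not_neutral)

lemma keys_sclD: "v \<in> Poly_Mapping.keys (scl c x) \<Longrightarrow> v \<in> Poly_Mapping.keys x"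
  by (auto simp: in_keys_iff)

lemma keys_mulE:
  assumes "v \<in> Poly_Mapping.keys (mul x y)"
  obtains v1 v2 where "v = v1 @ v2" "v1 \<in> Poly_Mapping.keys x" "v2 \<in> Poly_Mapping.keys y"
  using assms unfolding mul_def lin_def
  by (fastforce dest!: keys_sumD keys_sclD simp: keys_single)

lemma keys_span_bas:
  assumes "x \<in> fv.span (bas ` A)"
  shows "Poly_Mapping.keys x \<subseteq> A"
  using assms
proof (induction rule: fv.span_induct_alt)
  case (step c x y)
  have "Poly_Mapping.keys (scl c x + y) \<subseteq> Poly_Mapping.keys (scl c x) \<union> Poly_Mapping.keys y"
    by (rule Poly_Mapping.keys_add)
  with step show ?case by (auto dest!: keys_sclD)
qed simp

lemma ksgn_add: "ksgn e (m + n) = ksgn e m * ksgn e n"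
  by (auto simp: ksgn_def)

lemma der_append:
  "der e deg D (v @ w) = mul (der e deg D v) (bas w) + scl (ksgn e (wsum deg v)) (mul (bas v) (der e deg D w))"
proof (induction v)
  case Nil
  show ?case by (simp add: wsum_def ksgn_def)
next
  case (Cons x v)
  have "mul (bas [x]) (mul (bas v) y) = mul (bas (x # v)) y" for y :: "'a list fv"
    by (simp flip: mul_assoc)
  with Cons show ?case
    by (simp add: mul_assoc ksgn_add wsum_def scl_add_right algebra_simps)
qed

lemma der_leibniz:
  assumes "\<And>v. v \<in> Poly_Mapping.keys x \<Longrightarrow> wsum deg v = n"
  shows "lin (der e deg D) (mul x y) = mul (lin (der e deg D) x) y + scl (ksgn e n) (mul x (lin (der e deg D) y))"
proof (induction x rule: fv_induct)
  case (bas v)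
  then have "wsum deg v = n" by (rule assms)
  then show ?case
    by (induction y rule: fv_induct) (auto simp: der_append scl_add_right algebra_simps)
qed (auto simp: scl_add_right algebra_simps)

text \<open>
  If \<open>V\<close> is the space given by generators \<open>X\<close> and relations \<open>K\<close>, then the graded symmetric algebra
  \<open>Sym(V)\<close> is the span of the words in \<open>X\<close> modulo the following ideal.
\<close>

definition sym_null :: "'x set \<Rightarrow> ('x \<Rightarrow> int) \<Rightarrow> 'x fv set \<Rightarrow> 'x list fv set" where
  "sym_null X deg K = fv.span
    ({mul (bas v) (mul (lin (\<lambda>x. bas [x]) k) (bas w)) | v k w. v \<in> lists X \<and> k \<in> K \<and> w \<in> lists X} \<union>
     {bas (v @ [x, y] @ w) - scl (ksgn (deg x) (deg y)) (bas (v @ [y, x] @ w)) | v x y w.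
        v @ [x, y] @ w \<in> lists X})"

definition wspan :: "'x set \<Rightarrow> ('x \<Rightarrow> int) \<Rightarrow> int \<Rightarrow> 'x list fv set" where
  "wspan X deg i = fv.span (bas ` {w \<in> lists X. wsum deg w = i})"


section \<open>Complexes, homology, Euler characteristics\<close>

text \<open>
  A complex \<open>V\<close> consists of subspaces \<open>gr V i\<close>, a subspace \<open>null V\<close> and a map \<open>bdry V\<close> of degree \<open>-1\<close>; its
  component of degree \<open>i\<close> is \<open>gr V i / (gr V i \<inter> null V)\<close>.
\<close>

record 'k cplx =
  gr :: "int \<Rightarrow> 'k fv set"
  null :: "'k fv set"
  bdry :: "'k fv \<Rightarrow> 'k fv"

definition cycles :: "'k cplx \<Rightarrow> int \<Rightarrow> 'k fv set" where
  "cycles V i = {x \<in> gr V i. bdry V x \<in> null V}"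

definition homologous :: "'k cplx \<Rightarrow> int \<Rightarrow> ('k fv \<times> 'k fv) set" where
  "homologous V i =
    {(x, y). x \<in> cycles V i \<and> y \<in> cycles V i \<and> (\<exists>z\<in>gr V (i + 1). x - y - bdry V z \<in> null V)}"

definition homology :: "'k cplx \<Rightarrow> int \<Rightarrow> 'k fv set set" where
  "homology V i = cycles V i // homologous V i"

definition chain_map :: "'k cplx \<Rightarrow> 'j cplx \<Rightarrow> ('k fv \<Rightarrow> 'j fv) \<Rightarrow> bool" where
  "chain_map V V' f \<longleftrightarrow> Vector_Spaces.linear scl scl f \<and>
    (\<forall>i. \<forall>x\<in>gr V i. f x \<in> gr V' i \<and> (x \<in> null V \<longrightarrow> f x \<in> null V') \<and>
                     f (bdry V x) - bdry V' (f x) \<in> null V')"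

definition homology_map :: "'j cplx \<Rightarrow> ('k fv \<Rightarrow> 'j fv) \<Rightarrow> int \<Rightarrow> 'k fv set \<Rightarrow> 'j fv set" where
  "homology_map V' f i c = homologous V' i `` (f ` c)"

definition quasi_iso :: "'k cplx \<Rightarrow> 'j cplx \<Rightarrow> ('k fv \<Rightarrow> 'j fv) \<Rightarrow> bool" where
  "quasi_iso V V' f \<longleftrightarrow> chain_map V V' f \<and>
    (\<forall>i. bij_betw (homology_map V' f i) (homology V i) (homology V' i))"

text \<open>
  \<open>wt m\<close> is the ambient subspace of weight \<open>m\<close>. The dimension of the weight \<open>m\<close> part of degree \<open>i\<close> is that of
  a quotient \<open>A / (A \<inter> null V)\<close>, with \<open>A\<close> finite-dimensional. The result is the function giving the
  coefficient of \<open>q^a t^b\<close>; see \<open>weight_components_finite_dim\<close> below for the finiteness.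
\<close>

definition weight_dim :: "'k cplx \<Rightarrow> (int \<times> int \<Rightarrow> 'k fv set) \<Rightarrow> int \<Rightarrow> int \<times> int \<Rightarrow> nat" where
  "weight_dim V wt i m = fv.dim (gr V i \<inter> wt m) - fv.dim (gr V i \<inter> wt m \<inter> null V)"

definition weighted_euler :: "'k cplx \<Rightarrow> (int \<times> int \<Rightarrow> 'k fv set) \<Rightarrow> int \<times> int \<Rightarrow> int" where
  "weighted_euler V wt m =
    (\<Sum>i | weight_dim V wt i m \<noteq> 0. (if even i then 1 else - 1) * int (weight_dim V wt i m))"


section \<open>The cobar construction of a symmetric coalgebra\<close>

text \<open>
  Let \<open>\<aa>\<close> be the abelian graded Lie algebra, with zero differential, with basis \<open>'x\<close>, where
  \<open>x\<close> has degree \<open>\<delta> x\<close>. The coalgebra \<open>C = Sym\<^sup>c(\<aa>[1])\<close> (with zero differential, as \<open>\<aa>\<close> is abelian)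
  is spanned by the words in \<open>'x\<close> modulo graded commutativity; its coproduct is the unshuffle coproduct,
  that is, it is multiplicative with the elements of \<open>\<aa>[1]\<close> primitive.
\<close>

definition susp_deg :: "('x \<Rightarrow> int) \<Rightarrow> 'x \<Rightarrow> int" where
  "susp_deg \<delta> x = \<delta> x + 1"

definition coalg_null :: "('x \<Rightarrow> int) \<Rightarrow> 'x list fv set" where
  "coalg_null \<delta> = sym_null UNIV (susp_deg \<delta>) {}"

primrec coprod :: "('x \<Rightarrow> int) \<Rightarrow> 'x list \<Rightarrow> ('x list \<times> 'x list) fv" where
  "coprod \<delta> [] = bas ([], [])"
| "coprod \<delta> (x # w) = lin (\<lambda>(w1, w2). bas (x # w1, w2) +
      scl (ksgn (susp_deg \<delta> x) (wsum (susp_deg \<delta>) w1)) (bas (w1, x # w2))) (coprod \<delta> w)"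

text \<open>The coaugmentation coideal of \<open>C\<close> is spanned by the nonempty words; \<open>gen_deg\<close> is the degree in its
  desuspension.\<close>

definition gen_deg :: "('x \<Rightarrow> int) \<Rightarrow> 'x list \<Rightarrow> int" where
  "gen_deg \<delta> w = wsum (susp_deg \<delta>) w - 1"

text \<open>The free graded Lie algebra on a space with generators \<open>X\<close> and relations \<open>K\<close>: bracket
  expressions modulo the ideal generated by \<open>K\<close>, graded antisymmetry and the graded Jacobi identity.\<close>

datatype 'c bracketing = Gen 'c | Brk "'c bracketing" "'c bracketing"

primrec brk_deg :: "('c \<Rightarrow> int) \<Rightarrow> 'c bracketing \<Rightarrow> int" where
  "brk_deg deg (Gen c) = deg c"
| "brk_deg deg (Brk s t) = brk_deg deg s + brk_deg deg t"

definition brk :: "'c bracketing fv \<Rightarrow> 'c bracketing fv \<Rightarrow> 'c bracketing fv" where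
  "brk x y = lin (\<lambda>s. lin (\<lambda>t. bas (Brk s t)) y) x"

lemma brk_simps:
  "brk (x + y) z = brk x z + brk y z" "brk x (y + z) = brk x y + brk x z"
  "brk (scl c x) z = scl c (brk x z)" "brk x (scl c y) = scl c (brk x y)"
  "brk 0 x = 0" "brk x 0 = 0" "brk (bas s) (bas t) = bas (Brk s t)"
  by (simp_all add: brk_def lin_add_fun lin_scl_fun) (simp_all add: lin_def)

definition bracketings :: "'c set \<Rightarrow> 'c bracketing set" where
  "bracketings X = {t. set_bracketing t \<subseteq> X}"

inductive_set lie_null :: "'c set \<Rightarrow> ('c \<Rightarrow> int) \<Rightarrow> 'c fv set \<Rightarrow> 'c bracketing fv set"
  for X :: "'c set" and deg :: "'c \<Rightarrow> int" and K :: "'c fv set" where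
  rel: "k \<in> K \<Longrightarrow> lin (\<lambda>c. bas (Gen c)) k \<in> lie_null X deg K"
| antisym: "\<lbrakk>s \<in> bracketings X; t \<in> bracketings X\<rbrakk> \<Longrightarrow>
    bas (Brk s t) + scl (ksgn (brk_deg deg s) (brk_deg deg t)) (bas (Brk t s)) \<in> lie_null X deg K"
| jacobi: "\<lbrakk>r \<in> bracketings X; s \<in> bracketings X; t \<in> bracketings X\<rbrakk> \<Longrightarrow>
    bas (Brk r (Brk s t)) - bas (Brk (Brk r s) t)
      - scl (ksgn (brk_deg deg r) (brk_deg deg s)) (bas (Brk s (Brk r t))) \<in> lie_null X deg K"
| left: "\<lbrakk>s \<in> bracketings X; x \<in> lie_null X deg K\<rbrakk> \<Longrightarrow> brk (bas s) x \<in> lie_null X deg K"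
| right: "\<lbrakk>x \<in> lie_null X deg K; t \<in> bracketings X\<rbrakk> \<Longrightarrow> brk x (bas t) \<in> lie_null X deg K"
| zero: "0 \<in> lie_null X deg K"
| add: "\<lbrakk>x \<in> lie_null X deg K; y \<in> lie_null X deg K\<rbrakk> \<Longrightarrow> x + y \<in> lie_null X deg K"
| scale: "x \<in> lie_null X deg K \<Longrightarrow> scl c x \<in> lie_null X deg K"

text \<open>\<open>\<LL> = \<Omega>(C)\<close> is the free graded Lie algebra on the desuspension of the coaugmentation coideal of \<open>C\<close>.\<close>

definition om_gens :: "'x list bracketing set" where
  "om_gens = bracketings {w. w \<noteq> []}"

definition om_deg :: "('x \<Rightarrow> int) \<Rightarrow> 'x list bracketing \<Rightarrow> int" where
  "om_deg \<delta> = brk_deg (gen_deg \<delta>)"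

definition om_null :: "('x \<Rightarrow> int) \<Rightarrow> 'x list bracketing fv set" where
  "om_null \<delta> = lie_null {w. w \<noteq> []} (gen_deg \<delta>) (coalg_null \<delta>)"

text \<open>Writing \<open>c' \<otimes> c''\<close> for the terms of the reduced coproduct, \<open>d(s\<^sup>-\<^sup>1 c)\<close> is half the sum of
  \<open>(-1)^|c'| [s\<^sup>-\<^sup>1 c', s\<^sup>-\<^sup>1 c'']\<close>. By cocommutativity, in the tensor algebra this is the usual cobar
  differential, the sum of \<open>(-1)^|c'| s\<^sup>-\<^sup>1 c' \<otimes> s\<^sup>-\<^sup>1 c''\<close>.\<close>

primrec om_diff :: "('x \<Rightarrow> int) \<Rightarrow> 'x list bracketing \<Rightarrow> 'x list bracketing fv" where
  "om_diff \<delta> (Gen w) =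
    lin (\<lambda>(w1, w2). if w1 = [] \<or> w2 = [] then 0
          else scl (ksgn 1 (wsum (susp_deg \<delta>) w1) / 2) (bas (Brk (Gen w1) (Gen w2)))) (coprod \<delta> w)"
| "om_diff \<delta> (Brk s t) =
    brk (om_diff \<delta> s) (bas t) + scl (ksgn (- 1) (om_deg \<delta> s)) (brk (bas s) (om_diff \<delta> t))"


section \<open>Reductive Lie algebras\<close>

locale complex_lie_algebra = finite_dimensional_vector_space scale B
  for scale :: "complex \<Rightarrow> 'g::ab_group_add \<Rightarrow> 'g" and B :: "'g set" +
  fixes br :: "'g \<Rightarrow> 'g \<Rightarrow> 'g"
  assumes br_add_left: "br (x + y) z = br x z + br y z"
    and br_add_right: "br x (y + z) = br x y + br x z"
    and br_scale_left: "br (scale c x) y = scale c (br x y)"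
    and br_scale_right: "br x (scale c y) = scale c (br x y)"
    and br_self: "br x x = 0"
    and br_jacobi: "br x (br y z) + br y (br z x) + br z (br x y) = 0"
begin

definition bracket_span :: "'g set \<Rightarrow> 'g set \<Rightarrow> 'g set" where
  "bracket_span S T = span {br x y | x y. x \<in> S \<and> y \<in> T}"

definition solvable :: "'g set \<Rightarrow> bool" where
  "solvable S \<longleftrightarrow> (\<exists>n. ((\<lambda>T. bracket_span T T) ^^ n) S = {0})"

definition nilpotent :: "'g set \<Rightarrow> bool" where
  "nilpotent S \<longleftrightarrow> (\<exists>n. (bracket_span S ^^ n) S = {0})"

definition lie_ideal :: "'g set \<Rightarrow> bool" where
  "lie_ideal I \<longleftrightarrow> subspace I \<and> (\<forall>x. \<forall>y\<in>I. br x y \<in> I)"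

definition radical :: "'g set" where
  "radical = span (\<Union>{I. lie_ideal I \<and> solvable I})"

definition center :: "'g set" where
  "center = {z. \<forall>x. br z x = 0}"

definition cartan_subalgebra :: "'g set \<Rightarrow> bool" where
  "cartan_subalgebra H \<longleftrightarrow> subspace H \<and> (\<forall>x\<in>H. \<forall>y\<in>H. br x y \<in> H) \<and> nilpotent H \<and>
    {x. \<forall>h\<in>H. br x h \<in> H} = H"

text \<open>Functionals on \<open>H\<close> are represented by functions on \<open>'g\<close>, of which only the values on \<open>H\<close> matter;
  likewise for the elements of the Weyl group.\<close>

definition root_space :: "'g set \<Rightarrow> ('g \<Rightarrow> complex) \<Rightarrow> 'g set" where
  "root_space H \<alpha> = {x. \<forall>h\<in>H. br h x = scale (\<alpha> h) x}"

definition is_root :: "'g set \<Rightarrow> ('g \<Rightarrow> complex) \<Rightarrow> bool" where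
  "is_root H \<alpha> \<longleftrightarrow>
    (\<forall>x\<in>H. \<forall>y\<in>H. \<forall>c. \<alpha> (x + y) = \<alpha> x + \<alpha> y \<and> \<alpha> (scale c x) = c * \<alpha> x) \<and>
    (\<exists>h\<in>H. \<alpha> h \<noteq> 0) \<and> root_space H \<alpha> \<noteq> {0}"

definition is_coroot :: "'g set \<Rightarrow> ('g \<Rightarrow> complex) \<Rightarrow> 'g \<Rightarrow> bool" where
  "is_coroot H \<alpha> k \<longleftrightarrow>
    k \<in> H \<inter> bracket_span (root_space H \<alpha>) (root_space H (\<lambda>h. - \<alpha> h)) \<and> \<alpha> k = 2"

inductive_set weyl_group :: "'g set \<Rightarrow> ('g \<Rightarrow> 'g) set" for H :: "'g set" where
  one: "id \<in> weyl_group H"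
| reflect: "\<lbrakk>\<omega> \<in> weyl_group H; is_root H \<alpha>; is_coroot H \<alpha> k\<rbrakk> \<Longrightarrow>
    (\<lambda>h. h - scale (\<alpha> h) k) \<circ> \<omega> \<in> weyl_group H"

text \<open>
  \<open>Sym\<^sup>n(\<gg>\<^sup>*)\<close> is the space of symmetric \<open>n\<close>-linear forms on \<open>\<gg>\<close>, which are functions on lists of length \<open>n\<close>.
  A form \<open>F\<close> corresponds to the polynomial function \<open>\<lambda>x. F(x,\<dots>,x)\<close>; the product of \<open>Sym(\<gg>\<^sup>*)\<close> is that of
  polynomial functions, and the pairing of \<open>F\<close> with \<open>x\<^sub>1\<cdots>x\<^sub>n \<in> Sym\<^sup>n(\<gg>)\<close> is \<open>F(x\<^sub>1,\<dots>,x\<^sub>n)\<close>.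
\<close>

definition invariant_form :: "nat \<Rightarrow> ('g list \<Rightarrow> complex) \<Rightarrow> bool" where
  "invariant_form n F \<longleftrightarrow>
    (\<forall>xs ys x y c. Suc (length xs + length ys) = n \<longrightarrow>
       F (xs @ (x + y) # ys) = F (xs @ x # ys) + F (xs @ y # ys) \<and>
       F (xs @ scale c x # ys) = c * F (xs @ x # ys)) \<and>
    (\<forall>xs ys. length xs = n \<and> mset xs = mset ys \<longrightarrow> F xs = F ys) \<and>
    (\<forall>y xs. length xs = n \<longrightarrow> (\<Sum>j<n. F (xs[j := br y (xs ! j)])) = 0)"

definition eval_poly :: "(nat \<Rightarrow> 'g \<Rightarrow> complex) \<Rightarrow> ((nat \<Rightarrow>\<^sub>0 nat) \<Rightarrow>\<^sub>0 complex) \<Rightarrow> 'g \<Rightarrow> complex" where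
  "eval_poly P q x = (\<Sum>m\<in>Poly_Mapping.keys q. Poly_Mapping.lookup q m * (\<Prod>i\<in>Poly_Mapping.keys m. P i x ^ Poly_Mapping.lookup m i))"

definition fundamental_invariants :: "nat \<Rightarrow> (nat \<Rightarrow> nat) \<Rightarrow> (nat \<Rightarrow> 'g list \<Rightarrow> complex) \<Rightarrow> bool" where
  "fundamental_invariants l d F \<longleftrightarrow>
    (let P = (\<lambda>i x. F i (replicate (d i) x));
         Q = {q. \<forall>m\<in>Poly_Mapping.keys q. Poly_Mapping.keys m \<subseteq> {1..l}}
     in (\<forall>i\<in>{1..l}. invariant_form (d i) (F i)) \<and>
        (\<forall>n G. invariant_form n G \<longrightarrow> (\<exists>q\<in>Q. \<forall>x. G (replicate n x) = eval_poly P q x)) \<and>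
        (\<forall>q\<in>Q. (\<forall>x. eval_poly P q x = 0) \<longrightarrow> q = 0))"

end

locale reductive_lie_algebra = complex_lie_algebra +
  assumes radical_eq_center: "radical = center"


section \<open>Derived representation algebras\<close>

text \<open>
  A letter \<open>(b, w)\<close> stands for \<open>b\<^sup>* \<otimes> s\<^sup>-\<^sup>1 w\<close>, where \<open>b\<^sup>*\<close> is the element dual to \<open>b\<close> of the dual basis of
  the basis \<open>S\<close> (of \<open>\<gg>\<close> or \<open>\<hh>\<close>); \<open>coef_null S \<delta>\<close> are the relations of
  the graded symmetric algebra on the dual space tensored with the desuspension of the coaugmentation coideal of \<open>C\<close>.
\<close>

definition coef_gens :: "'g set \<Rightarrow> ('g \<times> 'x list) set" where
  "coef_gens S = S \<times> {w. w \<noteq> []}"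

definition coef_deg :: "('x \<Rightarrow> int) \<Rightarrow> 'g \<times> 'x list \<Rightarrow> int" where
  "coef_deg \<delta> a = gen_deg \<delta> (snd a)"

definition coef_null :: "'g set \<Rightarrow> ('x \<Rightarrow> int) \<Rightarrow> ('g \<times> 'x list) list fv set" where
  "coef_null S \<delta> = sym_null (coef_gens S) (coef_deg \<delta>)
    {lin (\<lambda>w. bas (b, w)) k | b k. b \<in> S \<and> k \<in> coalg_null \<delta>}"

definition weight_space :: "'g set \<Rightarrow> ('x \<Rightarrow> int \<times> int) \<Rightarrow> int \<times> int \<Rightarrow> ('g \<times> 'x list) list fv set" where
  "weight_space B \<mu> m = fv.span (bas ` {w \<in> lists (coef_gens B). wsum (\<lambda>(b, v). wsum \<mu> v) w = m})"

context complex_lie_algebra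
begin

text \<open>The universal representation \<open>\<pi>\<close>: an element of \<open>\<gg> \<otimes> A\<close> is given by its coefficients in \<open>A\<close> with
  respect to the basis \<open>B\<close>. There are no signs in the bracket since \<open>\<gg>\<close> is in degree 0.\<close>

primrec univ_rep :: "'x list bracketing \<Rightarrow> 'g \<Rightarrow> ('g \<times> 'x list) list fv" where
  "univ_rep (Gen w) = (\<lambda>b. bas [(b, w)])"
| "univ_rep (Brk s t) = (\<lambda>b. \<Sum>b1\<in>B. \<Sum>b2\<in>B.
      scl (representation B (br b1 b2) b) (mul (univ_rep s b1) (univ_rep t b2)))"

text \<open>The differential of \<open>\<LL>\<^sub>\<gg>\<close> is the unique derivation for which \<open>\<pi>\<close> commutes with the
  differentials (see \<open>univ_rep_om_diff\<close>), as the universal property of \<open>\<LL>\<^sub>\<gg>\<close> demands.\<close>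

definition rep_diff :: "('x \<Rightarrow> int) \<Rightarrow> ('g \<times> 'x list) list fv \<Rightarrow> ('g \<times> 'x list) list fv" where
  "rep_diff \<delta> = lin (der (- 1) (coef_deg \<delta>)
    (\<lambda>(b, w). lin (\<lambda>t. univ_rep t b) (om_diff \<delta> (Gen w))))"

lemma univ_rep_deg:
  "v \<in> Poly_Mapping.keys (univ_rep t b) \<Longrightarrow> wsum (coef_deg \<delta>) v = om_deg \<delta> t"
proof (induction t arbitrary: v b)
  case (Gen w)
  then show ?case by (simp add: wsum_def coef_deg_def om_deg_def)
next
  case (Brk s t)
  from Brk.prems obtain b1 b2 where "v \<in> Poly_Mapping.keys (mul (univ_rep s b1) (univ_rep t b2))"
    by (auto dest!: keys_sumD keys_sclD)
  then obtain v1 v2 where "v = v1 @ v2"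
    and v: "v1 \<in> Poly_Mapping.keys (univ_rep s b1)" "v2 \<in> Poly_Mapping.keys (univ_rep t b2)"
    by (rule keys_mulE)
  with Brk.IH(1)[OF v(1)] Brk.IH(2)[OF v(2)] show ?case
    by (simp add: wsum_def om_deg_def)
qed

lemma univ_rep_brk:
  "lin (\<lambda>s. univ_rep s b) (brk x y) = (\<Sum>b1\<in>B. \<Sum>b2\<in>B. scl (representation B (br b1 b2) b)
     (mul (lin (\<lambda>s. univ_rep s b1) x) (lin (\<lambda>s. univ_rep s b2) y)))"
proof (induction x rule: fv_induct)
  case (bas s)
  show ?case
    by (induction y rule: fv_induct)
      (simp_all add: brk_simps scl_add_right sum.distrib fv.scale_sum_right mult.commute)
qed (simp_all add: brk_simps scl_add_right sum.distrib fv.scale_sum_right mult.commute)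

lemma univ_rep_om_diff:
  "lin (\<lambda>s. univ_rep s b) (om_diff \<delta> t) = rep_diff \<delta> (univ_rep t b)"
proof (induction t arbitrary: b)
  case (Gen w)
  show ?case
    by (simp add: rep_diff_def mul_one del: om_diff.simps)
next
  case (Brk s t)
  have "rep_diff \<delta> (mul (univ_rep s b1) (univ_rep t b2)) =
      mul (rep_diff \<delta> (univ_rep s b1)) (univ_rep t b2) +
      scl (ksgn (- 1) (om_deg \<delta> s)) (mul (univ_rep s b1) (rep_diff \<delta> (univ_rep t b2)))" for b1 b2
    unfolding rep_diff_def by (rule der_leibniz) (rule univ_rep_deg)
  moreover have "rep_diff \<delta> (scl c x) = scl c (rep_diff \<delta> x)" "rep_diff \<delta> (sum g A) = (\<Sum>a\<in>A. rep_diff \<delta> (g a))"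
    for c x A and g :: "'g \<Rightarrow> _"
    by (simp_all add: rep_diff_def lin_sum)
  ultimately show ?case
    by (simp add: univ_rep_brk Brk.IH scl_add_right sum.distrib fv.scale_sum_right mult.commute)
qed

text \<open>The action of \<open>\<gg>\<close> by derivations extending the coadjoint action
  \<open>y b\<^sup>* = - b\<^sup>* \<circ> ad y = - \<Sum>\<^sub>c b\<^sup>*([y, c]) c\<^sup>*\<close>.\<close>

definition coad_action :: "'g \<Rightarrow> ('g \<times> 'x list) list fv \<Rightarrow> ('g \<times> 'x list) list fv" where
  "coad_action y = lin (der 0 (\<lambda>_. 0)
    (\<lambda>(b, w). \<Sum>c\<in>B. scl (- representation B (br y c) b) (bas [(c, w)])))"

definition drep_inv :: "('x \<Rightarrow> int) \<Rightarrow> ('g \<times> 'x list) list cplx" where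
  "drep_inv \<delta> = \<lparr>
     gr = (\<lambda>i. {x \<in> wspan (coef_gens B) (coef_deg \<delta>) i. \<forall>y. coad_action y x \<in> coef_null B \<delta>}),
     null = coef_null B \<delta>,
     bdry = rep_diff \<delta>\<rparr>"

subsection \<open>The derived Harish-Chandra map\<close>

text \<open>In the following, \<open>HB\<close> is a basis of the Cartan subalgebra \<open>H\<close>. A Weyl group element \<open>\<omega>\<close> acts on
  \<open>\<hh>\<^sup>*\<close> by \<open>c\<^sup>* \<mapsto> c\<^sup>* \<circ> \<omega>\<close>; replacing \<open>\<omega>\<close> by its inverse does not change the invariants.\<close>

definition weyl_action ::
    "'g set \<Rightarrow> ('g \<Rightarrow> 'g) \<Rightarrow> ('g \<times> 'x list) list fv \<Rightarrow> ('g \<times> 'x list) list fv" where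
  "weyl_action HB \<omega> = lin (alg_ext
    (\<lambda>(c, w). \<Sum>c'\<in>HB. scl (representation HB (\<omega> c') c) (bas [(c', w)])))"

definition hc_target :: "'g set \<Rightarrow> 'g set \<Rightarrow> ('x \<Rightarrow> int) \<Rightarrow> ('g \<times> 'x list) list cplx" where
  "hc_target H HB \<delta> = \<lparr>
     gr = (\<lambda>i. {x \<in> wspan (coef_gens HB) (coef_deg \<delta>) i.
              \<forall>\<omega>\<in>weyl_group H. weyl_action HB \<omega> x - x \<in> coef_null HB \<delta>}),
     null = coef_null HB \<delta>,
     bdry = (\<lambda>_. 0)\<rparr>"

definition hc_map :: "'g set \<Rightarrow> ('g \<times> 'x list) list fv \<Rightarrow> ('g \<times> 'x list) list fv" where
  "hc_map HB = lin (alg_ext (\<lambda>(b, w). \<Sum>c\<in>HB. scl (representation B c b) (bas [(c, w)])))"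

end


subsection \<open>The Drinfeld trace map\<close>

text \<open>\<open>Sym\<^sup>d(\<LL>)\<close> is spanned by the words of length \<open>d\<close> in the generators of \<open>\<LL>\<close>; to get \<open>\<lambda>\<^sup>(\<^sup>d\<^sup>)(\<LL>)\<close> one also
  divides by the image of the adjoint action, which is by graded derivations.\<close>

definition om_ad :: "('x \<Rightarrow> int) \<Rightarrow> 'x list bracketing \<Rightarrow> 'x list bracketing list \<Rightarrow> 'x list bracketing list fv" where
  "om_ad \<delta> t = der (om_deg \<delta> t) (om_deg \<delta>) (\<lambda>s. bas [Brk t s])"

definition lam_null :: "('x \<Rightarrow> int) \<Rightarrow> nat \<Rightarrow> 'x list bracketing list fv set" where
  "lam_null \<delta> d =
    fv.span (sym_null om_gens (om_deg \<delta>) (om_null \<delta>) \<union>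
             {om_ad \<delta> t w | t w. t \<in> om_gens \<and> w \<in> lists om_gens}) \<inter>
    fv.span (bas ` {w. length w = d})"

definition lam_diff :: "('x \<Rightarrow> int) \<Rightarrow> 'x list bracketing list \<Rightarrow> 'x list bracketing list fv" where
  "lam_diff \<delta> = der (- 1) (om_deg \<delta>) (\<lambda>t. lin (\<lambda>s. bas [s]) (om_diff \<delta> t))"

text \<open>The direct sum of the \<open>\<lambda>\<^sup>(\<^sup>d\<^sup>i\<^sup>)(\<LL>)\<close> for \<open>i = 1,\<dots>,l\<close>: the generator \<open>(i, w)\<close> is the word \<open>w\<close> of length
  \<open>d i\<close>, in the summand \<open>i\<close>.\<close>

definition lams_gens :: "nat \<Rightarrow> (nat \<Rightarrow> nat) \<Rightarrow> (nat \<times> 'x list bracketing list) set" where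
  "lams_gens l d = {(i, w). i \<in> {1..l} \<and> w \<in> lists om_gens \<and> length w = d i}"

definition lams_deg :: "('x \<Rightarrow> int) \<Rightarrow> nat \<times> 'x list bracketing list \<Rightarrow> int" where
  "lams_deg \<delta> a = wsum (om_deg \<delta>) (snd a)"

definition sym_lams :: "('x \<Rightarrow> int) \<Rightarrow> nat \<Rightarrow> (nat \<Rightarrow> nat) \<Rightarrow> (nat \<times> 'x list bracketing list) list cplx" where
  "sym_lams \<delta> l d = \<lparr>
     gr = wspan (lams_gens l d) (lams_deg \<delta>),
     null = sym_null (lams_gens l d) (lams_deg \<delta>)
       {lin (\<lambda>w. bas (i, w)) k | i k. i \<in> {1..l} \<and> k \<in> lam_null \<delta> (d i)},
     bdry = lin (der (- 1) (lams_deg \<delta>) (\<lambda>(i, w). lin (\<lambda>w'. bas [(i, w')]) (lam_diff \<delta> w)))\<rparr>"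

context complex_lie_algebra
begin

text \<open>The trace of \<open>x\<^sub>1\<cdots>x\<^sub>n\<close> is the sum of \<open>F(b\<^sub>1,\<dots>,b\<^sub>n) \<pi>(x\<^sub>1)\<^sub>b\<^sub>1 \<cdots> \<pi>(x\<^sub>n)\<^sub>b\<^sub>n\<close> over all \<open>b\<^sub>1,\<dots>,b\<^sub>n \<in> B\<close>.\<close>

definition form_trace :: "('g list \<Rightarrow> complex) \<Rightarrow> 'x list bracketing list \<Rightarrow> ('g \<times> 'x list) list fv" where
  "form_trace F w = (\<Sum>bs | bs \<in> lists B \<and> length bs = length w.
     scl (F bs) (foldr mul (map2 univ_rep w bs) (bas [])))"

definition drinfeld_map ::
    "(nat \<Rightarrow> 'g list \<Rightarrow> complex) \<Rightarrow> (nat \<times> 'x list bracketing list) list fv \<Rightarrow> ('g \<times> 'x list) list fv" where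
  "drinfeld_map F = lin (alg_ext (\<lambda>(i, w). form_trace (F i) w))"

end


section \<open>The Lie algebras \<open>\<aa>\<^sub>p\<^sub>,\<^sub>r\<close>\<close>

datatype uv = U | V

primrec uv_deg :: "int \<Rightarrow> int \<Rightarrow> uv \<Rightarrow> int" where
  "uv_deg p r U = p"
| "uv_deg p r V = r"

primrec uv_weight :: "uv \<Rightarrow> int \<times> int" where
  "uv_weight U = (1, 0)"
| "uv_weight V = (0, 1)"

lemma finite_uv_words: "finite {w :: uv list. length w \<le> n}"
proof -
  have "(UNIV :: uv set) = {U, V}" using uv.exhaust by auto
  then have "finite (UNIV :: uv set)" by (metis finite.emptyI finite.insertI)
  from finite_lists_length_le[OF this, of n] show ?thesis by simp
qed

lemma length_weight: "int (length w) = fst (wsum uv_weight w) + snd (wsum uv_weight w)"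
proof (induction w)
  case (Cons x w)
  then show ?case by (cases x) (simp_all add: wsum_def)
qed (simp add: wsum_def)

lemma finite_weight_words:
  assumes "finite B"
  shows "finite {w \<in> lists (coef_gens B). wsum (\<lambda>(b, v). wsum uv_weight v) w = m}" (is "finite ?A")
proof -
  let ?wt = "wsum (\<lambda>(b :: 'a, v). wsum uv_weight v)"
  let ?n = "nat (fst m + snd m)"
  have *: "int (length w) \<le> fst (?wt w) + snd (?wt w) \<and>
      (\<forall>a\<in>set w. int (length (snd a)) \<le> fst (?wt w) + snd (?wt w))" if "w \<in> lists (coef_gens B)" for w
    using that
  proof (induction w)
    case (Cons a w)
    obtain b v where a: "a = (b, v)" by force
    with Cons.hyps have "v \<noteq> []" by (auto simp: coef_gens_def)
    then have "int (length v) \<ge> 1" by (cases v) auto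
    moreover have "?wt (a # w) = wsum uv_weight v + ?wt w" by (simp add: wsum_def a)
    ultimately show ?case using Cons.IH length_weight[of v] by (fastforce simp: a)
  qed (simp add: wsum_def)
  have "?A \<subseteq> {w. set w \<subseteq> B \<times> {v. length v \<le> ?n} \<and> length w \<le> ?n}"
  proof
    fix w assume "w \<in> ?A"
    then have w: "w \<in> lists (coef_gens B)" and m: "?wt w = m" by auto
    have "length w \<le> ?n" "\<forall>a\<in>set w. length (snd a) \<le> ?n" using *[OF w] m by fastforce+
    moreover have "set w \<subseteq> B \<times> UNIV" using w by (auto simp: coef_gens_def)
    ultimately show "w \<in> {w. set w \<subseteq> B \<times> {v. length v \<le> ?n} \<and> length w \<le> ?n}" by fastforce
  qed
  moreover have "finite {w. set w \<subseteq> B \<times> {v :: uv list. length v \<le> ?n} \<and> length w \<le> ?n}"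
    using assms by (intro finite_lists_length_le finite_cartesian_product finite_uv_words)
  ultimately show ?thesis by (rule finite_subset)
qed

text \<open>The weighted Euler characteristic of \<open>DRep\<^sub>\<gg>(\<aa>\<^sub>p\<^sub>,\<^sub>r)\<^sup>G\<close> is well-defined.\<close>

lemma (in complex_lie_algebra) weight_components_finite_dim:
  fixes \<delta> :: "uv \<Rightarrow> int"
  shows "\<exists>S. finite S \<and> (\<forall>i. gr (drep_inv \<delta>) i \<inter> weight_space B uv_weight m \<subseteq> fv.span S)"
    and "finite {i. weight_dim (drep_inv \<delta>) (weight_space B uv_weight) i m \<noteq> 0}"
proof -
  let ?A = "{w \<in> lists (coef_gens B). wsum (\<lambda>(b, v). wsum uv_weight v) w = m}"
  have fin: "finite ?A" by (rule finite_weight_words[OF finite_Basis])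
  then show "\<exists>S. finite S \<and> (\<forall>i. gr (drep_inv \<delta>) i \<inter> weight_space B uv_weight m \<subseteq> fv.span S)"
    by (intro exI[of _ "bas ` ?A"]) (auto simp: weight_space_def)
  have "{i. weight_dim (drep_inv \<delta>) (weight_space B uv_weight) i m \<noteq> 0} \<subseteq> wsum (coef_deg \<delta>) ` ?A"
  proof
    fix i assume "i \<in> {i. weight_dim (drep_inv \<delta>) (weight_space B uv_weight) i m \<noteq> 0}"
    then have "weight_dim (drep_inv \<delta>) (weight_space B uv_weight) i m \<noteq> 0" by simp
    then have "fv.dim (gr (drep_inv \<delta>) i \<inter> weight_space B uv_weight m) \<noteq> 0"
      by (simp add: weight_dim_def)
    then have "\<not> gr (drep_inv \<delta>) i \<inter> weight_space B uv_weight m \<subseteq> {0}"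
      by (metis Diff_cancel card.empty fv.dim_span fv.dim_unique fv.independent_empty fv.span_empty
          fv.span_insert_0 fv.span_zero empty_subsetI subset_singleton_iff fv.dim_eq_card_independent)
    then obtain x where x: "x \<in> wspan (coef_gens B) (coef_deg \<delta>) i" "x \<in> weight_space B uv_weight m" "x \<noteq> 0"
      by (auto simp: drep_inv_def)
    from x(3) obtain w where "w \<in> Poly_Mapping.keys x" by (metis all_not_in_conv keys_eq_empty)
    with x(1,2) have "w \<in> ?A" "wsum (coef_deg \<delta>) w = i"
      by (auto simp: wspan_def weight_space_def dest!: keys_span_bas)
    then show "i \<in> wsum (coef_deg \<delta>) ` ?A" by blast
  qed
  then show "finite {i. weight_dim (drep_inv \<delta>) (weight_space B uv_weight) i m \<noteq> 0}"
    using fin by (meson finite_imageI finite_subset)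
qed

end

theory Submission
  imports Defs
begin

(* The weight of an element of DRep_g(a_{p,r}), or of either of the other two complexes, counts the
   letters u and v in it. Replacing (p, r) by (p', r') changes none of the signs, hence neither the
   relations nor the differentials nor the maps; it merely moves the part of weight (a, b) by the even
   number a (p' - p) + b (r' - r) of degrees. Everything being compatible with weights, homology can be
   compared weight by weight. *)

section \<open>Weight components\<close>

text \<open>The shift depends on the weight, so a new homology space in degree i is assembled from
  old ones in many different degrees, and no single translation of degrees identifies the two
  complexes. Hence everything is reduced to inclusions between subspaces of one ambient free vector
  space, where both gradings live side by side: \<open>regraded\<close> links two families of
  subspaces and survives intersections, sums, images and preimages under weight-preserving linear
  maps, and \<open>regraded_subset\<close> carries an inclusion valid in all old degrees to every
  new degree. Apart from linearity, being a chain map consists of such inclusions; bijectivity on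
  homology, a statement about sets of classes, is rewritten as four more.\<close>

definition prj :: "('k \<Rightarrow> 'm) \<Rightarrow> 'm \<Rightarrow> 'k fv \<Rightarrow> 'k fv" where
  "prj wt m = lin (\<lambda>k. if wt k = m then bas k else 0)"

lemma lookup_prj: "Poly_Mapping.lookup (prj wt m x) k = (if wt k = m then Poly_Mapping.lookup x k else 0)"
proof (induction x rule: fv_induct)
  case (bas j)
  show ?case by (auto simp: prj_def lookup_single when_def)
qed (auto simp: prj_def lookup_add)

lemma prj_simps [simp]:
  "prj wt m (x + y) = prj wt m x + prj wt m y" "prj wt m (scl c x) = scl c (prj wt m x)"
  "prj wt m 0 = 0" "prj wt m (x - y) = prj wt m x - prj wt m y"
  "prj wt m (prj wt n x) = (if m = n then prj wt m x else 0)"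
  by (auto intro!: poly_mapping_eqI simp: lookup_prj lookup_add lookup_minus)

lemma prj_sum: "prj wt m (\<Sum>i\<in>A. f i) = (\<Sum>i\<in>A. prj wt m (f i))"
  by (simp add: prj_def lin_sum)

lemma sum_prj: "(\<Sum>m\<in>wt ` Poly_Mapping.keys x. prj wt m x) = x"
  by (rule poly_mapping_eqI) (auto simp: lookup_sum lookup_prj in_keys_iff)

lemma prj_eq_0: "m \<notin> wt ` Poly_Mapping.keys x \<Longrightarrow> prj wt m x = 0"
  by (rule poly_mapping_eqI) (auto simp: lookup_prj in_keys_iff)

section \<open>Homogeneous elements and weight-preserving linear maps\<close>

definition homog :: "('k \<Rightarrow> 'm) \<Rightarrow> 'm \<Rightarrow> 'k fv \<Rightarrow> bool" where
  "homog wt m x \<longleftrightarrow> (\<forall>k\<in>Poly_Mapping.keys x. wt k = m)"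

lemma homog_prj: "homog wt m x \<Longrightarrow> prj wt n x = (if n = m then x else 0)"
  by (rule poly_mapping_eqI) (auto simp: lookup_prj homog_def in_keys_iff)

lemma homog_0 [simp]: "homog wt m 0"
  by (simp add: homog_def)

lemma homog_bas [simp]: "homog wt m (bas k) \<longleftrightarrow> wt k = m"
  by (simp add: homog_def)

lemma homog_add: "homog wt m x \<Longrightarrow> homog wt m y \<Longrightarrow> homog wt m (x + y)"
  unfolding homog_def using Poly_Mapping.keys_add[of x y] by blast

lemma homog_scl: "homog wt m x \<Longrightarrow> homog wt m (scl c x)"
  by (auto simp: homog_def dest: keys_sclD)

lemma homog_diff: "homog wt m x \<Longrightarrow> homog wt m y \<Longrightarrow> homog wt m (x - y)"
  unfolding homog_def using keys_diff[of x y] by blast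

lemma homog_uminus: "homog wt m x \<Longrightarrow> homog wt m (- x)"
  using homog_diff[of wt m 0 x] by simp

lemma homog_sum: "(\<And>i. i \<in> A \<Longrightarrow> homog wt m (f i)) \<Longrightarrow> homog wt m (\<Sum>i\<in>A. f i)"
  by (auto simp: homog_def dest!: keys_sumD)

lemma homog_lin:
  assumes "homog wt n x" "\<And>k. wt k = n \<Longrightarrow> homog wt' m (g k)"
  shows "homog wt' m (lin g x)"
  unfolding lin_def by (rule homog_sum, rule homog_scl, rule assms(2)) (use assms(1) in \<open>simp add: homog_def\<close>)

lemma wsum_simps [simp]:
  "wsum f [] = 0" "wsum f (x # w) = f x + wsum f w" "wsum f (v @ w) = wsum f v + wsum f w"
  by (simp_all add: wsum_def)

lemma homog_mul:
  "homog (wsum f) m x \<Longrightarrow> homog (wsum f) n y \<Longrightarrow> homog (wsum f) (m + n) (mul x y)"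
  by (auto simp: homog_def elim!: keys_mulE)

text \<open>For linear maps this amounts to sending each weight to itself. Stated as commutation
  with the projections, it yields at once that images and preimages of graded subspaces are
  graded.\<close>

definition wt_map :: "('k \<Rightarrow> 'm) \<Rightarrow> ('j \<Rightarrow> 'm) \<Rightarrow> ('k fv \<Rightarrow> 'j fv) \<Rightarrow> bool" where
  "wt_map wt wt' f \<longleftrightarrow> module_hom scl scl f \<and> (\<forall>m x. prj wt' m (f x) = f (prj wt m x))"

lemma module_hom_lin: "module_hom scl scl (lin g)"
  by (simp add: module_hom_iff fv.module_axioms)

lemma wt_map_lin:
  assumes "\<And>k. homog wt' (wt k) (g k)"
  shows "wt_map wt wt' (lin g)"
proof -
  have "prj wt' m (lin g x) = lin g (prj wt m x)" for m x
  proof (induction x rule: fv_induct)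
    case (bas k)
    show ?case using homog_prj[OF assms, of m k] by (simp add: prj_def)
  qed auto
  then show ?thesis by (simp add: wt_map_def module_hom_lin)
qed

lemma wt_map_comp: "wt_map wt wt' f \<Longrightarrow> wt_map wt' wt'' g \<Longrightarrow> wt_map wt wt'' (\<lambda>x. g (f x))"
  unfolding wt_map_def using module_hom_compose[of scl scl f scl g] by (simp add: o_def)

lemma wt_map_diff: "wt_map wt wt' f \<Longrightarrow> wt_map wt wt' g \<Longrightarrow> wt_map wt wt' (\<lambda>x. f x - g x)"
  unfolding wt_map_def module_hom_iff by (simp add: fv.scale_right_diff_distrib add_diff_add)

lemma wt_map_id: "wt_map wt wt (\<lambda>x. x)"
  by (simp add: wt_map_def module_hom_iff fv.module_axioms)

lemma wt_map_0: "wt_map wt wt' (\<lambda>x. 0)"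
  by (simp add: wt_map_def module_hom_iff fv.module_axioms)

text \<open>Equivalently, the subspace is the direct sum of its parts of pure weight, since every
  vector is the finite sum of its components (\<open>sum_prj\<close>).\<close>

definition graded :: "('k \<Rightarrow> 'm) \<Rightarrow> 'k fv set \<Rightarrow> bool" where
  "graded wt S \<longleftrightarrow> fv.subspace S \<and> (\<forall>m. \<forall>x\<in>S. prj wt m x \<in> S)"

lemma gradedD:
  assumes "graded wt S"
  shows "0 \<in> S" "x \<in> S \<Longrightarrow> y \<in> S \<Longrightarrow> x + y \<in> S" "x \<in> S \<Longrightarrow> y \<in> S \<Longrightarrow> x - y \<in> S"
    "x \<in> S \<Longrightarrow> prj wt m x \<in> S"
  using assms by (auto simp: graded_def fv.subspace_0 fv.subspace_add fv.subspace_diff)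

lemma graded_span:
  assumes "\<And>x m. x \<in> G \<Longrightarrow> prj wt m x \<in> fv.span G"
  shows "graded wt (fv.span G)"
proof -
  have "prj wt m x \<in> fv.span G" if "x \<in> fv.span G" for m x
    using that
    by (induction rule: fv.span_induct_alt) (simp_all add: fv.span_zero fv.span_add fv.span_scale assms)
  then show ?thesis by (simp add: graded_def)
qed

lemma graded_Int: "graded wt S \<Longrightarrow> graded wt T \<Longrightarrow> graded wt (S \<inter> T)"
  by (simp add: graded_def fv.subspace_inter)

lemma graded_vimage:
  assumes "wt_map wt wt' f" "graded wt' S"
  shows "graded wt (f -` S)"
proof -
  have "fv.subspace (f -` S)"
    by (rule module_hom.subspace_vimage[of scl scl]) (use assms in \<open>simp_all add: wt_map_def graded_def\<close>)
  moreover have "f (prj wt m x) \<in> S" if "f x \<in> S" for m x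
    using gradedD(4)[OF assms(2) that, of m] assms(1) by (simp add: wt_map_def)
  ultimately show ?thesis by (simp add: graded_def)
qed

lemma graded_image:
  assumes "wt_map wt wt' f" "graded wt S"
  shows "graded wt' (f ` S)"
proof -
  have "fv.subspace (f ` S)"
    by (rule module_hom.subspace_image[of scl scl]) (use assms in \<open>simp_all add: wt_map_def graded_def\<close>)
  moreover have "prj wt' m (f x) \<in> f ` S" if "x \<in> S" for m x
    using imageI[OF gradedD(4)[OF assms(2) that, of m], of f] assms(1) by (simp add: wt_map_def)
  ultimately show ?thesis by (simp add: graded_def)
qed

lemma graded_plus:
  assumes "graded wt S" "graded wt T"
  shows "graded wt {x + y | x y. x \<in> S \<and> y \<in> T}"
proof -
  have "prj wt m z \<in> {x + y | x y. x \<in> S \<and> y \<in> T}" if z: "z \<in> {x + y | x y. x \<in> S \<and> y \<in> T}" for m z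
  proof -
    from z obtain x y where "x \<in> S" "y \<in> T" "z = x + y" by blast
    then have "prj wt m x \<in> S" "prj wt m y \<in> T" "prj wt m z = prj wt m x + prj wt m y"
      using gradedD(4)[OF assms(1)] gradedD(4)[OF assms(2)] by simp_all
    then show ?thesis by blast
  qed
  then show ?thesis using assms by (simp add: graded_def fv.subspace_sums)
qed

text \<open>\<open>S'\<close> is obtained from \<open>S\<close> by moving the part of weight \<open>m\<close> up by \<open>s m\<close> degrees.\<close>

definition regraded :: "('k \<Rightarrow> 'm) \<Rightarrow> ('m \<Rightarrow> int) \<Rightarrow> (int \<Rightarrow> 'k fv set) \<Rightarrow> (int \<Rightarrow> 'k fv set) \<Rightarrow> bool" where
  "regraded wt s S S' \<longleftrightarrow> (\<forall>i. graded wt (S i)) \<and> (\<forall>i x. x \<in> S' i \<longleftrightarrow> (\<forall>m. prj wt m x \<in> S (i - s m)))"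

lemma regradedI:
  "(\<And>i. graded wt (S i)) \<Longrightarrow> (\<And>i x. x \<in> S' i \<longleftrightarrow> (\<forall>m. prj wt m x \<in> S (i - s m))) \<Longrightarrow> regraded wt s S S'"
  by (simp add: regraded_def)

lemma regradedD:
  assumes "regraded wt s S S'"
  shows "graded wt (S i)" "x \<in> S' i \<longleftrightarrow> (\<forall>m. prj wt m x \<in> S (i - s m))"
  using assms by (auto simp: regraded_def)

text \<open>Each condition defining \<open>S' i\<close> is linear, and a component of a component of
  x is that component again or 0.\<close>

lemma regraded_graded:
  assumes "regraded wt s S S'"
  shows "graded wt (S' i)"
  unfolding graded_def fv.subspace_def
  using regradedD(2)[OF assms] gradedD[OF regradedD(1)[OF assms]]
    fv.subspace_scale[of "S _"] regradedD(1)[OF assms, unfolded graded_def]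
  by auto

text \<open>Membership in \<open>S' i\<close> tests the components in the various degrees
  \<open>i - s m\<close>, so the inclusion is required in all degrees even to obtain it in one. This
  is how every statement is carried to the new grading.\<close>

lemma regraded_subset:
  assumes "regraded wt s S S'" "regraded wt s T T'" "\<And>i. S i \<subseteq> T i"
  shows "S' i \<subseteq> T' i"
  using regradedD(2)[OF assms(1)] regradedD(2)[OF assms(2)] assms(3) by blast

text \<open>Relations do not refer to degrees, so they form a constant family; it is its own
  regrading because a vector is the finite sum of its components.\<close>

lemma regraded_const:
  assumes "graded wt S"
  shows "regraded wt s (\<lambda>_. S) (\<lambda>_. S)"
proof (rule regradedI)
  fix x
  have "x \<in> S" if "\<forall>m. prj wt m x \<in> S"
    using fv.subspace_sum[of S "wt ` Poly_Mapping.keys x" "\<lambda>m. prj wt m x"] that assms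
    by (simp add: graded_def sum_prj)
  then show "x \<in> S \<longleftrightarrow> (\<forall>m. prj wt m x \<in> S)" using gradedD[OF assms] by blast
qed (rule assms)

text \<open>Serves the boundaries, which come from degree i + 1: translating all degrees by k
  commutes with the shifts \<open>s m\<close>.\<close>

lemma regraded_step:
  assumes "regraded wt s S S'"
  shows "regraded wt s (\<lambda>i. S (i + k)) (\<lambda>i. S' (i + k))"
proof -
  have "i + k - s m = i - s m + k" for i m by simp
  then show ?thesis using assms unfolding regraded_def by metis
qed

lemma regraded_Int:
  "regraded wt s S S' \<Longrightarrow> regraded wt s T T' \<Longrightarrow> regraded wt s (\<lambda>i. S i \<inter> T i) (\<lambda>i. S' i \<inter> T' i)"
  by (auto simp: regraded_def graded_Int)

lemma regraded_vimage:
  assumes "wt_map wt wt' f" "regraded wt' s S S'"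
  shows "regraded wt s (\<lambda>i. f -` S i) (\<lambda>i. f -` S' i)"
  using assms by (auto simp: regraded_def graded_vimage wt_map_def)

text \<open>Gluing: vectors chosen separately for finitely many weights assemble into one with the
  prescribed components.\<close>

lemma prj_sum_prj:
  "finite M \<Longrightarrow> prj wt m (\<Sum>n\<in>M. prj wt n (g n)) = (if m \<in> M then prj wt m (g m) else 0)"
  by (simp add: prj_sum if_distrib cong: if_cong)

lemma regraded_image:
  assumes f: "wt_map wt wt' f" and S: "regraded wt s S S'"
  shows "regraded wt' s (\<lambda>i. f ` S i) (\<lambda>i. f ` S' i)"
proof (rule regradedI)
  fix i y
  note gr = gradedD[OF regradedD(1)[OF S]]
  have f': "prj wt' m (f x) = f (prj wt m x)" for m x using f by (simp add: wt_map_def)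
  show "y \<in> f ` S' i \<longleftrightarrow> (\<forall>m. prj wt' m y \<in> f ` S (i - s m))"
  proof
    assume "y \<in> f ` S' i"
    then show "\<forall>m. prj wt' m y \<in> f ` S (i - s m)" using regradedD(2)[OF S] by (auto simp: f')
  next
    assume "\<forall>m. prj wt' m y \<in> f ` S (i - s m)"
    then have "\<forall>m. \<exists>x. x \<in> S (i - s m) \<and> f x = prj wt' m y" by (metis imageE)
    then obtain g where g: "\<And>m. g m \<in> S (i - s m)" "\<And>m. f (g m) = prj wt' m y" by metis
    let ?M = "wt' ` Poly_Mapping.keys y"
    \<comment> \<open>A preimage \<open>g n\<close> need not be homogeneous, so only its part of
      weight n is kept. Summing over the weights that occur in y is enough and keeps the sum
      finite.\<close>
    let ?x = "\<Sum>n\<in>?M. prj wt n (g n)"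
    have "?x \<in> S' i" unfolding regradedD(2)[OF S]
      by (simp add: prj_sum_prj gr g)
    moreover have "f ?x = (\<Sum>n\<in>?M. f (prj wt n (g n)))"
      using f module_hom.sum[of scl scl f] by (simp add: wt_map_def)
    then have "f ?x = y" by (simp add: f'[symmetric] g sum_prj)
    ultimately show "y \<in> f ` S' i" by (metis imageI)
  qed
qed (use assms in \<open>auto intro: graded_image simp: regraded_def\<close>)

lemma mem_plus_iff:
  fixes z :: "'a::ab_group_add"
  shows "z \<in> {x + y | x y. x \<in> A \<and> y \<in> B} \<longleftrightarrow> (\<exists>x\<in>A. z - x \<in> B)"
proof -
  have "z = x + y \<longleftrightarrow> y = z - x" for x y by (auto simp: algebra_simps)
  then show ?thesis by auto
qed

lemma regraded_plus:
  assumes S: "regraded wt s S S'" and T: "regraded wt s T T'"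
  shows "regraded wt s (\<lambda>i. {x + y | x y. x \<in> S i \<and> y \<in> T i}) (\<lambda>i. {x + y | x y. x \<in> S' i \<and> y \<in> T' i})"
proof (rule regradedI)
  fix i z
  note grS = gradedD[OF regradedD(1)[OF S]] and grT = gradedD[OF regradedD(1)[OF T]]
  show "z \<in> {x + y | x y. x \<in> S' i \<and> y \<in> T' i} \<longleftrightarrow>
      (\<forall>m. prj wt m z \<in> {x + y | x y. x \<in> S (i - s m) \<and> y \<in> T (i - s m)})"
  proof
    assume z: "z \<in> {x + y | x y. x \<in> S' i \<and> y \<in> T' i}"
    show "\<forall>m. prj wt m z \<in> {x + y | x y. x \<in> S (i - s m) \<and> y \<in> T (i - s m)}"
    proof (intro allI)
      fix m
      from z obtain x y where "x \<in> S' i" "y \<in> T' i" "z = x + y" by blast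
      then have "prj wt m x \<in> S (i - s m)" "prj wt m y \<in> T (i - s m)" "prj wt m z = prj wt m x + prj wt m y"
        using regradedD(2)[OF S] regradedD(2)[OF T] by simp_all
      then show "prj wt m z \<in> {x + y | x y. x \<in> S (i - s m) \<and> y \<in> T (i - s m)}" by blast
    qed
  next
    assume "\<forall>m. prj wt m z \<in> {x + y | x y. x \<in> S (i - s m) \<and> y \<in> T (i - s m)}"
    then have "\<forall>m. \<exists>x y. x \<in> S (i - s m) \<and> y \<in> T (i - s m) \<and> prj wt m z = x + y" by blast
    then obtain g h where g: "\<And>m. g m \<in> S (i - s m)" and h: "\<And>m. h m \<in> T (i - s m)"
      and gh: "\<And>m. prj wt m z = g m + h m" by metis
    have gh': "prj wt m z - prj wt m (g m) = prj wt m (h m)" for m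
      using arg_cong[OF gh[of m], of "prj wt m"] by simp
    let ?M = "wt ` Poly_Mapping.keys z"
    \<comment> \<open>Only the first summands are glued. The second summand is then
      \<open>z - ?x\<close>, whose component of weight m is that of \<open>h m\<close>, or 0 if m
      does not occur in z.\<close>
    let ?x = "\<Sum>n\<in>?M. prj wt n (g n)"
    have x: "?x \<in> S' i" unfolding regradedD(2)[OF S]
      by (simp add: prj_sum_prj grS g)
    have "prj wt m (z - ?x) \<in> T (i - s m)" for m
    proof (cases "m \<in> ?M")
      case True
      have "prj wt m ?x = prj wt m (g m)"
        unfolding prj_sum_prj[OF finite_imageI[OF finite_keys]] using True by simp
      then show ?thesis using h grT by (simp add: gh')
    next
      case False
      have "prj wt m ?x = 0"
        unfolding prj_sum_prj[OF finite_imageI[OF finite_keys]] using False by simp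
      then show ?thesis using grT prj_eq_0[OF False] by simp
    qed
    then have "z - ?x \<in> T' i" unfolding regradedD(2)[OF T] by blast
    then show "z \<in> {x + y | x y. x \<in> S' i \<and> y \<in> T' i}" using x unfolding mem_plus_iff by blast
  qed
qed (use assms in \<open>auto intro: graded_plus simp: regraded_def\<close>)

section \<open>Quasi-isomorphisms\<close>

text \<open>\<open>f\<close> is not assumed to send \<open>Z\<close> to \<open>Z'\<close>, hence the detour through \<open>E\<close>: a chain map sends cycles to
  cycles only if \<open>bdry V\<close> maps \<open>gr V i\<close> to \<open>gr V (i - 1)\<close>, which the criterion thus need not assume.\<close>

lemma bij_betw_quotient_iff:
  fixes Z D :: "'k fv set" and Z' D' :: "'j fv set"
  assumes sub: "fv.subspace Z" "fv.subspace D" "fv.subspace Z'" "fv.subspace D'"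
    and f: "module_hom scl scl f"
  defines "R \<equiv> {(x, y). x \<in> Z \<and> y \<in> Z \<and> x - y \<in> D}"
    and "R' \<equiv> {(x, y). x \<in> Z' \<and> y \<in> Z' \<and> x - y \<in> D'}"
    and "E \<equiv> Z \<inter> f -` Z'"
  shows "bij_betw (\<lambda>c. R' `` (f ` c)) (Z // R) (Z' // R') \<longleftrightarrow>
    Z \<subseteq> {x + y | x y. x \<in> E \<and> y \<in> D} \<and> E \<inter> D \<subseteq> f -` D' \<and> E \<inter> f -` D' \<subseteq> D \<and>
    Z' \<subseteq> {x + y | x y. x \<in> f ` E \<and> y \<in> D'}" (is "?bij \<longleftrightarrow> ?a \<and> ?b \<and> ?c \<and> ?d")
proof -
  have equivI: "equiv Z {(x, y). x \<in> Z \<and> y \<in> Z \<and> x - y \<in> D}"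
    if "fv.subspace Z" "fv.subspace D" for Z D :: "'l fv set"
  proof (rule equivI)
    show "refl_on Z {(x, y). x \<in> Z \<and> y \<in> Z \<and> x - y \<in> D}"
      using that by (auto simp: refl_on_def fv.subspace_0)
    show "sym {(x, y). x \<in> Z \<and> y \<in> Z \<and> x - y \<in> D}"
      using fv.subspace_neg[OF that(2)] by (fastforce simp: sym_def)
    show "trans {(x, y). x \<in> Z \<and> y \<in> Z \<and> x - y \<in> D}"
      using fv.subspace_add[OF that(2)] by (fastforce simp: trans_def)
  qed auto
  have R: "equiv Z R" and R': "equiv Z' R'"
    unfolding R_def R'_def by (intro equivI sub)+
  have f0: "f 0 = 0" and fd: "f (x - y) = f x - f y" for x y
    using module_hom.zero[OF f] module_hom.diff[OF f] by auto
  have 0: "0 \<in> Z" "0 \<in> D" "0 \<in> Z'" "0 \<in> D'" using sub fv.subspace_0 by auto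
  have E0: "0 \<in> E" using 0 by (simp add: E_def f0)
  \<comment> \<open>The four conditions say: every class of \<open>Z\<close> has a representative in
    \<open>E\<close>; on \<open>E\<close> the map is well defined on classes; it is injective there;
    it is surjective.\<close>
  show ?thesis
  proof
    assume bij: ?bij
    \<comment> \<open>Bijectivity includes that the image of a class is again a class of
      \<open>R'\<close>, whatever \<open>f\<close> does to members outside \<open>E\<close>.\<close>
    have cls: "R' `` (f ` (R `` {x})) \<in> Z' // R'" if "x \<in> Z" for x
      using bij that unfolding bij_betw_def by (blast intro: quotientI)
    have same: "(y, y') \<in> R'" if "x \<in> Z" "y \<in> R' `` (f ` (R `` {x}))" "y' \<in> R' `` (f ` (R `` {x}))" for x y y'
      using quotient_eqI[OF R' cls cls] that quotient_eq_iff[OF R' cls[OF that(1)] cls[OF that(1)]] by blast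
    have mem: "f x \<in> R' `` (f ` (R `` {x}))" "x \<in> Z" if "x \<in> E" for x
      using that 0 by (auto simp: R_def R'_def E_def)
    have a: ?a
    proof
      fix x assume x: "x \<in> Z"
      \<comment> \<open>Classes are nonempty and \<open>R'\<close> relates only members of
        \<open>Z'\<close>, so some e in the class of x is sent into \<open>Z'\<close>.\<close>
      from cls[OF x] obtain y where "y \<in> R' `` (f ` (R `` {x}))"
        using in_quotient_imp_non_empty[OF R'] by blast
      then obtain e where e: "e \<in> E" "x - e \<in> D" by (auto simp: R_def R'_def E_def)
      then show "x \<in> {x + y | x y. x \<in> E \<and> y \<in> D}" unfolding mem_plus_iff by blast
    qed
    have b: ?b
    proof
      fix x assume x: "x \<in> E \<inter> D"
      then have "(0, x) \<in> R" using fv.subspace_neg[OF sub(2)] 0 by (auto simp: R_def E_def)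
      then have "R `` {x} = R `` {0}" using equiv_class_eq[OF R] by simp
      then have "(f x, f 0) \<in> R'" using same[of x "f x" "f 0"] mem[of x] mem[OF E0] x by auto
      then show "x \<in> f -` D'" by (simp add: R'_def f0)
    qed
    have c: ?c
    proof
      fix x assume x: "x \<in> E \<inter> f -` D'"
      then have "(f x, f 0) \<in> R'" using 0 by (auto simp: R'_def E_def f0)
      moreover have xE: "x \<in> E" using x by simp
      ultimately have "R' `` (f ` (R `` {x})) = R' `` (f ` (R `` {0}))"
        using quotient_eqI[OF R' cls[OF mem(2)] cls[OF mem(2)] mem(1) mem(1), OF xE E0 xE E0] by simp
      then have "R `` {x} = R `` {0}"
        using inj_onD[OF bij_betw_imp_inj_on[OF bij]] quotientI[OF mem(2)[OF xE]] quotientI[OF mem(2)[OF E0]]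
        by simp
      then have "(x, 0) \<in> R" using eq_equiv_class[OF _ R] 0 by simp
      then show "x \<in> D" by (simp add: R_def)
    qed
    have d: ?d
    proof
      fix y assume y: "y \<in> Z'"
      then have "R' `` {y} \<in> (\<lambda>c. R' `` (f ` c)) ` (Z // R)"
        using bij_betw_imp_surj_on[OF bij] quotientI[OF y, of R'] by simp
      then obtain C where C: "C \<in> Z // R" "R' `` {y} = R' `` (f ` C)" by blast
      from C(1) obtain x where "x \<in> Z" "C = R `` {x}" by (rule quotientE)
      with C(2) have x: "x \<in> Z" "R' `` {y} = R' `` (f ` (R `` {x}))" by simp_all
      have "y \<in> R' `` {y}" using R' y by (rule equiv_class_self)
      then obtain e where e: "e \<in> E" "f e - y \<in> D'" unfolding x(2) by (auto simp: R_def R'_def E_def)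
      have "y = f e + (y - f e)" "y - f e \<in> D'" using fv.subspace_neg[OF sub(4) e(2)] by auto
      then show "y \<in> {x + y | x y. x \<in> f ` E \<and> y \<in> D'}" using e(1) by blast
    qed
    show "?a \<and> ?b \<and> ?c \<and> ?d" using a b c d by blast
  next
    assume abcd: "?a \<and> ?b \<and> ?c \<and> ?d"
    then have a: ?a and b: ?b and c: ?c and d: ?d by auto
    have E: "fv.subspace E" unfolding E_def
      using module_hom.subspace_vimage[OF f sub(3)] sub(1) by (simp add: fv.subspace_inter)
    \<comment> \<open>Members of the class of e that are not sent into \<open>Z'\<close> contribute
      nothing under \<open>R'\<close>; the others differ from e by an element of
      \<open>E \<inter> D\<close>, which \<open>f\<close> sends into \<open>D'\<close>.\<close>
    have img: "R' `` (f ` (R `` {e})) = R' `` {f e}" if e: "e \<in> E" for e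
    proof (rule set_eqI)
      fix y
      show "y \<in> R' `` (f ` (R `` {e})) \<longleftrightarrow> y \<in> R' `` {f e}"
      proof
        assume "y \<in> R' `` (f ` (R `` {e}))"
        then obtain x where x: "(e, x) \<in> R" "(f x, y) \<in> R'" by auto
        then have "x \<in> E" by (auto simp: R_def R'_def E_def)
        with e x(1) have "e - x \<in> E \<inter> D" using fv.subspace_diff[OF E] by (auto simp: R_def)
        then have "f e - f x \<in> D'" using b by (auto simp: fd)
        then have "(f e, f x) \<in> R'" using e \<open>x \<in> E\<close> by (auto simp: R'_def E_def)
        then show "y \<in> R' `` {f e}" using x(2) R' by (meson Image_singleton_iff equivE transD)
      next
        assume "y \<in> R' `` {f e}"
        then show "y \<in> R' `` (f ` (R `` {e}))" using e 0 by (auto simp: R_def E_def)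
      qed
    qed
    have rep: "\<exists>e\<in>E. C = R `` {e}" if "C \<in> Z // R" for C
    proof -
      from that obtain x where x: "x \<in> Z" "C = R `` {x}" by (rule quotientE)
      with a obtain e y where e: "e \<in> E" "y \<in> D" "x = e + y" by blast
      then have "(x, e) \<in> R" using x by (auto simp: R_def E_def)
      then show ?thesis using e(1) x(2) equiv_class_eq[OF R] by blast
    qed
    have EZ: "e \<in> Z" "f e \<in> Z'" if "e \<in> E" for e using that by (auto simp: E_def)
    show ?bij unfolding bij_betw_def
    proof
      show "inj_on (\<lambda>c. R' `` (f ` c)) (Z // R)"
      proof (rule inj_onI)
        fix C C' assume C: "C \<in> Z // R" "C' \<in> Z // R" "R' `` (f ` C) = R' `` (f ` C')"
        then obtain e e' where e: "e \<in> E" "e' \<in> E" "C = R `` {e}" "C' = R `` {e'}" using rep by metis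
        with C have "R' `` {f e} = R' `` {f e'}" by (simp add: img)
        then have "(f e, f e') \<in> R'" using eq_equiv_class[OF _ R'] EZ e by simp
        then have "f (e - e') \<in> D'" by (simp add: R'_def fd)
        then have "e - e' \<in> D" using c fv.subspace_diff[OF E] e by blast
        then have "(e, e') \<in> R" using e EZ by (auto simp: R_def)
        then show "C = C'" using e(3,4) equiv_class_eq[OF R] by simp
      qed
      show "(\<lambda>c. R' `` (f ` c)) ` (Z // R) = Z' // R'"
      proof
        show "(\<lambda>c. R' `` (f ` c)) ` (Z // R) \<subseteq> Z' // R'"
        proof (rule image_subsetI)
          fix C assume "C \<in> Z // R"
          then obtain e where "e \<in> E" "C = R `` {e}" using rep by blast
          then show "R' `` (f ` C) \<in> Z' // R'" using img quotientI[OF EZ(2)] by simp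
        qed
        show "Z' // R' \<subseteq> (\<lambda>c. R' `` (f ` c)) ` (Z // R)"
        proof
          fix C assume "C \<in> Z' // R'"
          then obtain y where y: "y \<in> Z'" "C = R' `` {y}" by (rule quotientE)
          with d obtain e z where e: "e \<in> E" "z \<in> D'" "y = f e + z" by blast
          then have "(y, f e) \<in> R'" using y EZ by (auto simp: R'_def)
          then have "C = R' `` (f ` (R `` {e}))" using e(1) y(2) equiv_class_eq[OF R'] img by simp
          then show "C \<in> (\<lambda>c. R' `` (f ` c)) ` (Z // R)" using quotientI[OF EZ(1)[OF e(1)]] by blast
        qed
      qed
    qed
  qed
qed

text \<open>Boundaries of the quotient complex, lifted to the ambient space; hence the relations are
  added. Two cycles are homologous iff their difference lies here, as the criterion for bijectivity
  requires.\<close>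

definition bounds :: "'k cplx \<Rightarrow> int \<Rightarrow> 'k fv set" where
  "bounds M i = {x + y | x y. x \<in> bdry M ` gr M (i + 1) \<and> y \<in> null M}"

lemma homologous_eq: "homologous M i = {(x, y). x \<in> cycles M i \<and> y \<in> cycles M i \<and> x - y \<in> bounds M i}"
proof -
  have "z \<in> bounds M i \<longleftrightarrow> (\<exists>w\<in>gr M (i + 1). z - bdry M w \<in> null M)" for z
    unfolding bounds_def mem_plus_iff by blast
  then show ?thesis by (simp add: homologous_def)
qed

locale regraded_cplx =
  fixes wt :: "'k \<Rightarrow> 'm" and s :: "'m \<Rightarrow> int" and M M' :: "'k cplx"
  assumes gr: "regraded wt s (gr M) (gr M')"
    and null: "graded wt (null M)" and null_eq: "null M' = null M"
    and bdry: "wt_map wt wt (bdry M)" and bdry_eq: "bdry M' = bdry M"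
begin

lemma cycles: "regraded wt s (cycles M) (cycles M')"
proof -
  have "cycles M = (\<lambda>i. gr M i \<inter> bdry M -` null M)" "cycles M' = (\<lambda>i. gr M' i \<inter> bdry M -` null M)"
    by (auto simp: cycles_def null_eq bdry_eq)
  then show ?thesis by (simp add: regraded_Int gr regraded_vimage[OF bdry] regraded_const null)
qed

lemma bounds: "regraded wt s (bounds M) (bounds M')"
  unfolding bounds_def null_eq bdry_eq
  by (rule regraded_plus[OF regraded_image[OF bdry regraded_step[OF gr]] regraded_const[OF null]])

end

text \<open>All seven inclusions, three for the chain map and four for homology, are between
  families built from \<open>gr\<close>, \<open>null\<close>, cycles and boundaries by operations
  compatible with \<open>regraded\<close>.\<close>

lemma quasi_iso_regraded:
  assumes "regraded_cplx wt s M M'" "regraded_cplx wt' s T T'" and f: "wt_map wt wt' f"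
    and qi: "quasi_iso M T f"
  shows "quasi_iso M' T' f"
proof -
  interpret M: regraded_cplx wt s M M' by fact
  interpret T: regraded_cplx wt' s T T' by fact
  have hom: "module_hom scl scl f" using f by (simp add: wt_map_def)
  have cm: "chain_map M T f" and bij: "bij_betw (homology_map T f i) (homology M i) (homology T i)" for i
    using qi by (auto simp: quasi_iso_def)
  \<comment> \<open>Commutation with the differentials holds only modulo relations, so it becomes an
    inclusion: \<open>gr M i\<close> lies in the preimage of \<open>null T\<close> under
    \<open>?h\<close>.\<close>
  let ?h = "\<lambda>x. f (bdry M x) - bdry T (f x)"
  have h: "wt_map wt wt' ?h"
    by (rule wt_map_diff[OF wt_map_comp[OF M.bdry f] wt_map_comp[OF f T.bdry]])
  note null = regraded_const[OF M.null] regraded_const[OF T.null]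
  have "gr M' i \<subseteq> f -` gr T' i" for i
    by (rule regraded_subset[OF M.gr regraded_vimage[OF f T.gr]]) (use cm in \<open>auto simp: chain_map_def\<close>)
  moreover have "gr M' i \<inter> null M \<subseteq> f -` null T" for i
    by (rule regraded_subset[OF regraded_Int[OF M.gr null(1)] regraded_vimage[OF f null(2)]])
      (use cm in \<open>auto simp: chain_map_def\<close>)
  moreover have "gr M' i \<subseteq> ?h -` null T" for i
    by (rule regraded_subset[OF M.gr regraded_vimage[OF h null(2)]])
      (use cm in \<open>auto simp: chain_map_def\<close>)
  ultimately have cm': "chain_map M' T' f"
    using cm M.null_eq T.null_eq M.bdry_eq T.bdry_eq unfolding chain_map_def by (simp add: subset_iff)
  \<comment> \<open>The complexes are arbitrary here: the criterion is read forwards for the old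
    pair and backwards for the new one.\<close>
  have crit: "bij_betw (homology_map T f i) (homology M i) (homology T i) \<longleftrightarrow>
    (cycles M i \<subseteq> {x + y | x y. x \<in> cycles M i \<inter> f -` cycles T i \<and> y \<in> bounds M i} \<and>
    cycles M i \<inter> f -` cycles T i \<inter> bounds M i \<subseteq> f -` bounds T i \<and>
    cycles M i \<inter> f -` cycles T i \<inter> f -` bounds T i \<subseteq> bounds M i \<and>
    cycles T i \<subseteq> {x + y | x y. x \<in> f ` (cycles M i \<inter> f -` cycles T i) \<and> y \<in> bounds T i})"
    if "graded wt (cycles M i)" "graded wt (bounds M i)" "graded wt' (cycles T i)" "graded wt' (bounds T i)"
    for M T i
    unfolding homology_map_def homology_def homologous_eq
    by (rule bij_betw_quotient_iff) (use that hom in \<open>auto simp: graded_def\<close>)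
  note crit1 = crit[OF regradedD(1)[OF M.cycles] regradedD(1)[OF M.bounds]
      regradedD(1)[OF T.cycles] regradedD(1)[OF T.bounds], THEN iffD1, OF bij]
  note crit2 = crit[OF regraded_graded[OF M.cycles] regraded_graded[OF M.bounds]
      regraded_graded[OF T.cycles] regraded_graded[OF T.bounds], THEN iffD2]
  have "bij_betw (homology_map T' f i) (homology M' i) (homology T' i)" for i
  proof (rule crit2, intro conjI)
    note E = regraded_Int[OF M.cycles regraded_vimage[OF f T.cycles]]
    show "cycles M' i \<subseteq> {x + y | x y. x \<in> cycles M' i \<inter> f -` cycles T' i \<and> y \<in> bounds M' i}"
      by (rule regraded_subset[OF M.cycles regraded_plus[OF E M.bounds]]) (use crit1 in blast)
    show "cycles M' i \<inter> f -` cycles T' i \<inter> bounds M' i \<subseteq> f -` bounds T' i"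
      by (rule regraded_subset[OF regraded_Int[OF E M.bounds] regraded_vimage[OF f T.bounds]])
        (use crit1 in blast)
    show "cycles M' i \<inter> f -` cycles T' i \<inter> f -` bounds T' i \<subseteq> bounds M' i"
      by (rule regraded_subset[OF regraded_Int[OF E regraded_vimage[OF f T.bounds]] M.bounds])
        (use crit1 in blast)
    show "cycles T' i \<subseteq> {x + y | x y. x \<in> f ` (cycles M' i \<inter> f -` cycles T' i) \<and> y \<in> bounds T' i}"
      by (rule regraded_subset[OF T.cycles regraded_plus[OF regraded_image[OF f E] T.bounds]])
        (use crit1 in blast)
  qed
  then show ?thesis using cm' by (simp add: quasi_iso_def)
qed

section \<open>Weights of the constructions\<close>

primrec brk_wt :: "('c \<Rightarrow> 'm::ab_group_add) \<Rightarrow> 'c bracketing \<Rightarrow> 'm" where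
  "brk_wt f (Gen c) = f c"
| "brk_wt f (Brk s t) = brk_wt f s + brk_wt f t"

text \<open>Written exactly as in \<open>weight_space\<close>, so that
  \<open>wsum (coef_wt uv_weight)\<close> is the weight by which the Euler characteristic is
  split.\<close>

abbreviation coef_wt :: "('x \<Rightarrow> 'm::ab_group_add) \<Rightarrow> 'g \<times> 'x list \<Rightarrow> 'm" where
  "coef_wt \<mu> \<equiv> \<lambda>(b, v). wsum \<mu> v"

abbreviation om_wt :: "('x \<Rightarrow> 'm::ab_group_add) \<Rightarrow> 'x list bracketing \<Rightarrow> 'm" where
  "om_wt \<mu> \<equiv> brk_wt (wsum \<mu>)"

abbreviation lams_wt :: "('x \<Rightarrow> 'm::ab_group_add) \<Rightarrow> nat \<times> 'x list bracketing list \<Rightarrow> 'm" where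
  "lams_wt \<mu> \<equiv> \<lambda>(i, w). wsum (om_wt \<mu>) w"

lemma homog_brk:
  assumes "homog (brk_wt f) m x" "homog (brk_wt f) n y"
  shows "homog (brk_wt f) (m + n) (brk x y)"
  unfolding brk_def by (rule homog_lin[OF assms(1)], rule homog_lin[OF assms(2)]) simp

lemma homog_alg_ext:
  assumes "\<And>x. homog (wsum g) (f x) (h x)"
  shows "homog (wsum g) (wsum f w) (alg_ext h w)"
  by (induction w) (simp_all add: homog_mul assms)

text \<open>Here n is the weight of the derivation. It is the weight of t for
  \<open>om_ad \<delta> t\<close>, and 0 for the differentials and the coadjoint action, whence the
  summand 0 in the later applications.\<close>

lemma homog_der:
  fixes f :: "'x \<Rightarrow> 'm::ab_group_add"
  assumes "\<And>x. homog (wsum f) (n + f x) (D x)"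
  shows "homog (wsum f) (n + wsum f w) (der e deg D w)"
proof (induction w)
  case (Cons x w)
  have "homog (wsum f) (n + wsum f (x # w)) (mul (D x) (bas w))"
    using homog_mul[OF assms[of x], of "wsum f w" "bas w"] by (simp add: add.assoc)
  moreover have "homog (wsum f) (n + wsum f (x # w)) (mul (bas [x]) (der e deg D w))"
    using homog_mul[OF _ Cons.IH, of "f x" "bas [x]"] by (simp add: add.left_commute)
  ultimately show ?case unfolding der.simps by (intro homog_add homog_scl)
qed simp

text \<open>Each term of the unshuffle coproduct distributes the letters of the word over the two
  factors.\<close>

lemma homog_coprod:
  fixes \<mu> :: "'x \<Rightarrow> 'm::ab_group_add"
  shows "homog (\<lambda>(w1, w2). wsum \<mu> w1 + wsum \<mu> w2) (wsum \<mu> w) (coprod \<delta> w)"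
proof (induction w)
  case (Cons x w)
  show ?case unfolding coprod.simps
    by (rule homog_lin[OF Cons.IH])
      (auto intro!: homog_add homog_scl simp: add.assoc add.left_commute[of _ "\<mu> x"])
qed simp

lemma homog_om_diff: "homog (om_wt \<mu>) (om_wt \<mu> t) (om_diff \<delta> t)"
proof (induction t)
  case (Gen w)
  show ?case unfolding om_diff.simps brk_wt.simps
    by (rule homog_lin[OF homog_coprod]) (auto intro!: homog_scl)
next
  case (Brk s t)
  show ?case unfolding om_diff.simps brk_wt.simps
    by (intro homog_add homog_scl homog_brk Brk.IH) simp_all
qed

context complex_lie_algebra
begin

text \<open>The Lie algebra carries no weight, so the coefficients at all basis vectors b have the
  same weight.\<close>

lemma homog_univ_rep: "homog (wsum (coef_wt \<mu>)) (om_wt \<mu> t) (univ_rep t b)"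
  by (induction t arbitrary: b) (simp_all add: homog_sum homog_scl homog_mul)

lemma wt_map_rep_diff: "wt_map (wsum (coef_wt \<mu>)) (wsum (coef_wt \<mu>)) (rep_diff \<delta>)"
proof -
  have "homog (wsum (coef_wt \<mu>)) (0 + coef_wt \<mu> a)
      (case a of (b, w) \<Rightarrow> lin (\<lambda>t. univ_rep t b) (om_diff \<delta> (Gen w)))" for a :: "'g \<times> 'a list"
  proof -
    obtain b w where a: "a = (b, w)" by force
    have "homog (wsum (coef_wt \<mu>)) (om_wt \<mu> (Gen w)) (lin (\<lambda>t. univ_rep t b) (om_diff \<delta> (Gen w)))"
      \<comment> \<open>The equation of weights is reversed so that it rewrites the weight of
        \<open>Gen w\<close> into that of t.\<close>
      by (rule homog_lin[OF homog_om_diff[of \<mu>]]) (drule sym, simp only: homog_univ_rep)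
    then show ?thesis by (simp add: a del: om_diff.simps)
  qed
  from homog_der[OF this] show ?thesis
    unfolding rep_diff_def by (intro wt_map_lin) simp
qed

lemma wt_map_coad_action: "wt_map (wsum (coef_wt \<mu>)) (wsum (coef_wt \<mu>)) (coad_action y)"
proof -
  have "homog (wsum (coef_wt \<mu>)) (0 + coef_wt \<mu> a)
      (case a of (b, w) \<Rightarrow> \<Sum>c\<in>B. scl (- representation B (br y c) b) (bas [(c, w)]))" for a :: "'g \<times> 'a list"
    by (cases a) (auto intro!: homog_sum homog_uminus homog_scl)
  from homog_der[OF this] show ?thesis
    unfolding coad_action_def by (intro wt_map_lin) simp
qed

lemma wt_map_weyl_action: "wt_map (wsum (coef_wt \<mu>)) (wsum (coef_wt \<mu>)) (weyl_action HB \<omega>)"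
  unfolding weyl_action_def
  by (intro wt_map_lin homog_alg_ext) (auto intro!: homog_sum homog_scl)

lemma wt_map_hc_map: "wt_map (wsum (coef_wt \<mu>)) (wsum (coef_wt \<mu>)) (hc_map HB)"
  unfolding hc_map_def
  by (intro wt_map_lin homog_alg_ext) (auto intro!: homog_sum homog_scl)

lemma homog_form_trace: "homog (wsum (coef_wt \<mu>)) (wsum (om_wt \<mu>) w) (form_trace F w)"
proof -
  have "homog (wsum (coef_wt \<mu>)) (wsum (om_wt \<mu>) w) (foldr mul (map2 univ_rep w bs) (bas []))"
    if "length w = length bs" for bs
    using that by (induction w bs rule: list_induct2) (simp_all add: homog_mul homog_univ_rep)
  then show ?thesis unfolding form_trace_def by (intro homog_sum homog_scl) simp
qed

lemma wt_map_drinfeld_map: "wt_map (wsum (lams_wt \<mu>)) (wsum (coef_wt \<mu>)) (drinfeld_map F)"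
  unfolding drinfeld_map_def
  by (intro wt_map_lin homog_alg_ext) (auto intro: homog_form_trace)

end

lemma homog_lam_diff: "homog (wsum (om_wt \<mu>)) (wsum (om_wt \<mu>) w) (lam_diff \<delta> w)"
proof -
  have "homog (wsum (om_wt \<mu>)) (0 + om_wt \<mu> t) (lin (\<lambda>s. bas [s]) (om_diff \<delta> t))" for t :: "'a list bracketing"
    by (rule homog_lin[OF homog_om_diff]) simp
  from homog_der[OF this] show ?thesis unfolding lam_diff_def by simp
qed

lemma wt_map_sym_lams: "wt_map (wsum (lams_wt \<mu>)) (wsum (lams_wt \<mu>)) (bdry (sym_lams \<delta> l d))"
proof -
  have "homog (wsum (lams_wt \<mu>)) (0 + lams_wt \<mu> a) (case a of (i, w) \<Rightarrow> lin (\<lambda>w'. bas [(i, w')]) (lam_diff \<delta> w))"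
    for a :: "nat \<times> 'a list bracketing list"
  proof -
    obtain i w where a: "a = (i, w)" by force
    show ?thesis unfolding a prod.case by (rule homog_lin[OF homog_lam_diff]) simp
  qed
  from homog_der[OF this] show ?thesis
    unfolding sym_lams_def cplx.simps by (intro wt_map_lin) simp
qed

section \<open>Weights of the relations\<close>

text \<open>The commutativity relations are homogeneous, as both words have the same letters. For
  \<open>K\<close> closure under components is the right condition: in \<open>coef_null\<close> it
  is a union of subspaces, one for each b.\<close>

lemma graded_sym_null:
  fixes f :: "'x \<Rightarrow> 'm::ab_group_add"
  assumes "\<And>k m. k \<in> K \<Longrightarrow> prj f m k \<in> K"
  shows "graded (wsum f) (sym_null X deg K)"
  unfolding sym_null_def
proof (rule graded_span)
  let ?T = "\<lambda>v k w. mul (bas v) (mul (lin (\<lambda>x. bas [x]) k) (bas w))"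
  let ?A = "{?T v k w | v k w. v \<in> lists X \<and> k \<in> K \<and> w \<in> lists X}"
  let ?B = "{bas (v @ [x, y] @ w) - scl (ksgn (deg x) (deg y)) (bas (v @ [y, x] @ w)) | v x y w.
        v @ [x, y] @ w \<in> lists X}"
  fix z m
  assume "z \<in> ?A \<union> ?B"
  then show "prj (wsum f) m z \<in> fv.span (?A \<union> ?B)"
  proof
    assume "z \<in> ?A"
    then obtain v k w where z: "z = ?T v k w" and vkw: "v \<in> lists X" "k \<in> K" "w \<in> lists X" by blast
    \<comment> \<open>Multiplying by the words v and w shifts all weights by a constant.\<close>
    have "prj (wsum f) m (?T v x w) = ?T v (prj f (m - wsum f v - wsum f w) x) w" for x
    proof (induction x rule: fv_induct)
      case (bas x)
      have "wsum f v + (f x + wsum f w) = m \<longleftrightarrow> f x = m - wsum f v - wsum f w"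
        by (auto simp: algebra_simps)
      then show ?case by (simp add: prj_def)
    qed simp_all
    then have "prj (wsum f) m z \<in> ?A" using vkw assms unfolding z by blast
    then show ?thesis by (simp add: fv.span_base)
  next
    assume "z \<in> ?B"
    then obtain v x y w where z: "z = bas (v @ [x, y] @ w) - scl (ksgn (deg x) (deg y)) (bas (v @ [y, x] @ w))"
      by blast
    have "homog (wsum f) (wsum f (v @ [x, y] @ w)) z"
      unfolding z by (intro homog_diff homog_scl) (simp_all add: add_ac)
    then show ?thesis using \<open>z \<in> ?B\<close> by (simp add: homog_prj fv.span_base fv.span_zero)
  qed
qed

lemma graded_coalg_null:
  fixes \<mu> :: "'x \<Rightarrow> 'm::ab_group_add"
  shows "graded (wsum \<mu>) (coalg_null \<delta>)"
  unfolding coalg_null_def by (rule graded_sym_null) simp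

lemma graded_coef_null: "graded (wsum (coef_wt \<mu>)) (coef_null S \<delta>)"
  unfolding coef_null_def
proof (rule graded_sym_null)
  fix z m
  assume "z \<in> {lin (\<lambda>w. bas (b, w)) k | b k. b \<in> S \<and> k \<in> coalg_null \<delta>}"
  then obtain b k where z: "z = lin (\<lambda>w. bas (b, w)) k" and k: "b \<in> S" "k \<in> coalg_null \<delta>" by blast
  have "wt_map (wsum \<mu>) (coef_wt \<mu>) (lin (\<lambda>w. bas (b, w)))" by (rule wt_map_lin) simp
  then have "prj (coef_wt \<mu>) m z = lin (\<lambda>w. bas (b, w)) (prj (wsum \<mu>) m k)"
    by (simp add: wt_map_def z)
  then show "prj (coef_wt \<mu>) m z \<in> {lin (\<lambda>w. bas (b, w)) k | b k. b \<in> S \<and> k \<in> coalg_null \<delta>}"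
    using k gradedD(4)[OF graded_coalg_null] by blast
qed

lemma prj_brk:
  "prj (brk_wt f) m (brk (bas s) x) = brk (bas s) (prj (brk_wt f) (m - brk_wt f s) x)"
  "prj (brk_wt f) m (brk x (bas s)) = brk (prj (brk_wt f) (m - brk_wt f s) x) (bas s)"
proof -
  have eq: "brk_wt f s + brk_wt f t = m \<longleftrightarrow> brk_wt f t = m - brk_wt f s"
    "brk_wt f t + brk_wt f s = m \<longleftrightarrow> brk_wt f t = m - brk_wt f s" for t
    by (auto simp: algebra_simps)
  show "prj (brk_wt f) m (brk (bas s) x) = brk (bas s) (prj (brk_wt f) (m - brk_wt f s) x)"
  proof (induction x rule: fv_induct)
    case (bas t)
    show ?case by (simp add: prj_def brk_simps eq)
  qed (simp_all add: brk_simps)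
  show "prj (brk_wt f) m (brk x (bas s)) = brk (prj (brk_wt f) (m - brk_wt f s) x) (bas s)"
  proof (induction x rule: fv_induct)
    case (bas t)
    show ?case by (simp add: prj_def brk_simps eq)
  qed (simp_all add: brk_simps)
qed

lemma subspace_lie_null: "fv.subspace (lie_null X deg K)"
  by (simp add: fv.subspace_def lie_null.zero lie_null.add lie_null.scale)

lemma graded_lie_null:
  assumes "graded f K"
  shows "graded (brk_wt f) (lie_null X deg K)"
proof -
  have hom: "prj (brk_wt f) m x \<in> lie_null X deg K"
    if "homog (brk_wt f) n x" "x \<in> lie_null X deg K" for m n x
    using that by (simp add: homog_prj lie_null.zero)
  have "prj (brk_wt f) m x \<in> lie_null X deg K" if "x \<in> lie_null X deg K" for m x
    using that
  \<comment> \<open>Bracketing with s changes the weight to be projected to by that of s, so m must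
    vary.\<close>
  proof (induction arbitrary: m)
    case (rel k)
    have "wt_map f (brk_wt f) (lin (\<lambda>c. bas (Gen c)))" by (rule wt_map_lin) simp
    then have "prj (brk_wt f) m (lin (\<lambda>c. bas (Gen c)) k) = lin (\<lambda>c. bas (Gen c)) (prj f m k)"
      by (simp add: wt_map_def)
    then show ?case using lie_null.rel[OF gradedD(4)[OF assms rel]] by simp
  next
    case (antisym s t)
    show ?case
      by (rule hom[OF _ lie_null.antisym[OF antisym], of "brk_wt f (Brk s t)"])
        (auto intro!: homog_add homog_scl simp: add_ac)
  next
    case (jacobi r s t)
    show ?case
      by (rule hom[OF _ lie_null.jacobi[OF jacobi], of "brk_wt f (Brk r (Brk s t))"])
        (auto intro!: homog_diff homog_scl simp: add_ac)
  next
    case (left s x)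
    then show ?case by (simp add: prj_brk lie_null.left)
  next
    case (right x t)
    then show ?case by (simp add: prj_brk lie_null.right)
  qed (simp_all add: lie_null.zero lie_null.add lie_null.scale)
  then show ?thesis by (simp add: graded_def subspace_lie_null)
qed

lemma graded_om_null: "graded (om_wt \<mu>) (om_null \<delta>)"
  unfolding om_null_def by (intro graded_lie_null graded_coalg_null)

lemma graded_lam_null: "graded (wsum (om_wt \<mu>)) (lam_null \<delta> d)"
  unfolding lam_null_def
proof (intro graded_Int graded_span)
  let ?N = "sym_null om_gens (om_deg \<delta>) (om_null \<delta>)"
  let ?A = "{om_ad \<delta> t w | t w. t \<in> om_gens \<and> w \<in> lists om_gens}"
  fix x m
  assume "x \<in> ?N \<union> ?A"
  then show "prj (wsum (om_wt \<mu>)) m x \<in> fv.span (?N \<union> ?A)"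
  proof
    assume x: "x \<in> ?N"
    have "graded (wsum (om_wt \<mu>)) ?N"
      by (rule graded_sym_null) (rule gradedD(4)[OF graded_om_null])
    from gradedD(4)[OF this x] show ?thesis by (simp add: fv.span_base)
  next
    assume x: "x \<in> ?A"
    then obtain t w where "x = om_ad \<delta> t w" by blast
    then have "homog (wsum (om_wt \<mu>)) (om_wt \<mu> t + wsum (om_wt \<mu>) w) x"
      by (simp add: om_ad_def homog_der)
    then show ?thesis using x by (simp add: homog_prj fv.span_base fv.span_zero)
  qed
next
  fix x m
  assume "x \<in> bas ` {w :: 'a list bracketing list. length w = d}"
  then show "prj (wsum (om_wt \<mu>)) m x \<in> fv.span (bas ` {w. length w = d})"
    by (auto simp: prj_def fv.span_zero fv.span_base)
qed

lemma graded_sym_lams: "graded (wsum (lams_wt \<mu>)) (null (sym_lams \<delta> l d))"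
  unfolding sym_lams_def cplx.simps
proof (rule graded_sym_null)
  fix z m
  assume "z \<in> {lin (\<lambda>w. bas (i, w)) k | i k. i \<in> {1..l} \<and> k \<in> lam_null \<delta> (d i)}"
  then obtain i k where z: "z = lin (\<lambda>w. bas (i, w)) k" and k: "i \<in> {1..l}" "k \<in> lam_null \<delta> (d i)" by blast
  have "wt_map (wsum (om_wt \<mu>)) (lams_wt \<mu>) (lin (\<lambda>w. bas (i, w)))" by (rule wt_map_lin) simp
  then have "prj (lams_wt \<mu>) m z = lin (\<lambda>w. bas (i, w)) (prj (wsum (om_wt \<mu>)) m k)"
    by (simp add: wt_map_def z)
  then show "prj (lams_wt \<mu>) m z \<in> {lin (\<lambda>w. bas (i, w)) k | i k. i \<in> {1..l} \<and> k \<in> lam_null \<delta> (d i)}"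
    using k gradedD(4)[OF graded_lam_null] by blast
qed

section \<open>Signs depend only on parities\<close>

lemma sym_null_parity:
  assumes "\<And>x. even (deg' x) \<longleftrightarrow> even (deg x)"
  shows "sym_null X deg' K = sym_null X deg K"
  by (simp add: sym_null_def ksgn_def assms)

lemma brk_deg_parity:
  "(\<And>x. even (deg' x) \<longleftrightarrow> even (deg x)) \<Longrightarrow> even (brk_deg deg' t) \<longleftrightarrow> even (brk_deg deg t)"
  by (induction t) simp_all

lemma lie_null_parity:
  assumes "\<And>x. even (deg' x) \<longleftrightarrow> even (deg x)"
  shows "lie_null X deg' K = lie_null X deg K"
proof -
  \<comment> \<open>The two degree functions enter symmetrically, so one inclusion for an arbitrary
    pair gives equality.\<close>
  have le: "x \<in> lie_null X deg2 K" if "x \<in> lie_null X deg1 K" and par: "\<And>x. even (deg1 x) \<longleftrightarrow> even (deg2 x)"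
    for x and deg1 deg2 :: "'a \<Rightarrow> int"
    using that(1)
  proof induction
    case (antisym s t)
    show ?case using lie_null.antisym[OF antisym, of deg2 K] by (simp add: ksgn_def brk_deg_parity[OF par])
  next
    case (jacobi r s t)
    show ?case using lie_null.jacobi[OF jacobi, of deg2 K] by (simp add: ksgn_def brk_deg_parity[OF par])
  qed (auto intro: lie_null.intros)
  show ?thesis using le assms by blast
qed

lemma der_parity:
  assumes "even e' \<longleftrightarrow> even e" "\<And>x. even (deg' x) \<longleftrightarrow> even (deg x)"
  shows "der e' deg' D = der e deg D"
proof
  show "der e' deg' D w = der e deg D w" for w
    by (induction w) (simp_all add: ksgn_def assms)
qed

text \<open>Additivity of \<open>s\<close> passes the shift from letters to words, brackets and
  words of brackets, the offset of the suspension cancelling; evenness preserves every Koszul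
  sign.\<close>

locale regrading =
  fixes \<mu> :: "'x \<Rightarrow> 'm::ab_group_add" and s :: "'m \<Rightarrow> int" and \<delta> \<delta>' :: "'x \<Rightarrow> int"
  assumes s_add: "s (m + n) = s m + s n"
    and s_even: "even (s m)"
    and deg_eq: "\<delta>' x = \<delta> x + s (\<mu> x)"
begin

section \<open>Degrees, signs and relations after the change of degrees\<close>

lemma s_0 [simp]: "s 0 = 0"
  using s_add[of 0 0] by simp

lemma wsum_eq:
  assumes "\<And>a. deg' a = deg a + s (f a)"
  shows "wsum deg' w = wsum deg w + s (wsum f w)"
  by (induction w) (simp_all add: assms s_add)

lemma susp_eq: "wsum (susp_deg \<delta>') w = wsum (susp_deg \<delta>) w + s (wsum \<mu> w)"
  by (rule wsum_eq) (simp add: susp_deg_def deg_eq)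

lemma gen_deg_eq: "gen_deg \<delta>' w = gen_deg \<delta> w + s (wsum \<mu> w)"
  by (simp add: gen_deg_def susp_eq)

lemma coef_deg_eq: "coef_deg \<delta>' a = coef_deg \<delta> a + s (coef_wt \<mu> a)"
  by (cases a) (simp add: coef_deg_def gen_deg_eq)

lemma om_deg_eq: "om_deg \<delta>' t = om_deg \<delta> t + s (om_wt \<mu> t)"
  by (induction t) (simp_all add: om_deg_def gen_deg_eq s_add)

lemma lams_deg_eq: "lams_deg \<delta>' a = lams_deg \<delta> a + s (lams_wt \<mu> a)"
  by (cases a) (simp add: lams_deg_def wsum_eq[OF om_deg_eq])

lemma parity:
  "even (susp_deg \<delta>' x) \<longleftrightarrow> even (susp_deg \<delta> x)"
  "even (wsum (susp_deg \<delta>') w) \<longleftrightarrow> even (wsum (susp_deg \<delta>) w)"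
  "even (gen_deg \<delta>' w) \<longleftrightarrow> even (gen_deg \<delta> w)"
  "even (coef_deg \<delta>' a) \<longleftrightarrow> even (coef_deg \<delta> a)"
  "even (om_deg \<delta>' t) \<longleftrightarrow> even (om_deg \<delta> t)"
  "even (lams_deg \<delta>' b) \<longleftrightarrow> even (lams_deg \<delta> b)"
  by (simp_all add: susp_deg_def deg_eq susp_eq gen_deg_eq coef_deg_eq om_deg_eq lams_deg_eq s_even)

lemma coalg_null_eq: "coalg_null \<delta>' = coalg_null \<delta>"
  unfolding coalg_null_def by (rule sym_null_parity) (rule parity)

lemma coprod_eq: "coprod \<delta>' w = coprod \<delta> w"
  by (induction w) (simp_all add: ksgn_def parity)

lemma om_diff_eq: "om_diff \<delta>' t = om_diff \<delta> t"
  by (induction t) (simp_all add: ksgn_def parity coprod_eq cong: if_cong)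

lemma coef_null_eq: "coef_null S \<delta>' = coef_null S \<delta>"
  unfolding coef_null_def coalg_null_eq by (rule sym_null_parity) (rule parity)

lemma om_null_eq: "om_null \<delta>' = om_null \<delta>"
  unfolding om_null_def coalg_null_eq by (rule lie_null_parity) (rule parity)

lemma lam_null_eq: "lam_null \<delta>' d = lam_null \<delta> d"
proof -
  have "om_ad \<delta>' t = om_ad \<delta> t" for t
    unfolding om_ad_def by (rule der_parity) (rule parity)+
  moreover have "sym_null om_gens (om_deg \<delta>') (om_null \<delta>') = sym_null om_gens (om_deg \<delta>) (om_null \<delta>)"
    unfolding om_null_eq by (rule sym_null_parity) (rule parity)
  ultimately show ?thesis unfolding lam_null_def by simp
qed

lemma sym_lams_eq:
  "null (sym_lams \<delta>' l d) = null (sym_lams \<delta> l d)" "bdry (sym_lams \<delta>' l d) = bdry (sym_lams \<delta> l d)"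
proof -
  show "null (sym_lams \<delta>' l d) = null (sym_lams \<delta> l d)"
    unfolding sym_lams_def cplx.simps lam_null_eq by (rule sym_null_parity) (rule parity)
  have "lam_diff \<delta>' = lam_diff \<delta>"
    unfolding lam_diff_def om_diff_eq by (rule der_parity) (simp_all add: parity)
  then show "bdry (sym_lams \<delta>' l d) = bdry (sym_lams \<delta> l d)"
    using der_parity[of "- 1" "- 1" "lams_deg \<delta>'" "lams_deg \<delta>"] by (simp add: sym_lams_def parity)
qed

text \<open>Membership in a span of basis words depends only on the support, and a word of weight m
  has new degree i iff its old degree is \<open>i - s m\<close>.\<close>

lemma regraded_wspan:
  assumes "\<And>a. deg' a = deg a + s (f a)"
  shows "regraded (wsum f) s (wspan X deg) (wspan X deg')"
proof -
  have wspan: "x \<in> wspan X deg i \<longleftrightarrow> Poly_Mapping.keys x \<subseteq> {w \<in> lists X. wsum deg w = i}" (is "_ \<longleftrightarrow> ?K \<subseteq> ?A")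
    for x :: "'c list fv" and X deg i
  proof
    show "x \<in> wspan X deg i \<Longrightarrow> ?K \<subseteq> ?A" unfolding wspan_def by (rule keys_span_bas)
    have "x \<in> fv.span (bas ` ?K)"
      by (rule fv_induct[where z = x and P = "\<lambda>y. y \<in> fv.span (bas ` Poly_Mapping.keys x)"])
        (simp_all add: fv.span_zero fv.span_add fv.span_scale fv.span_base)
    moreover assume "?K \<subseteq> ?A"
    then have "fv.span (bas ` ?K) \<subseteq> wspan X deg i" unfolding wspan_def by (intro fv.span_mono image_mono)
    ultimately show "x \<in> wspan X deg i" by (rule rev_subsetD)
  qed
  have keys: "Poly_Mapping.keys (prj (wsum f) m x) = {w \<in> Poly_Mapping.keys x. wsum f w = m}" for m x
    by (rule set_eqI) (simp add: in_keys_iff lookup_prj)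
  show ?thesis
  proof (rule regradedI)
    show "graded (wsum f) (wspan X deg i)" for i
    proof -
      have "fv.subspace (wspan X deg i)" by (simp add: wspan_def)
      moreover have "prj (wsum f) m x \<in> wspan X deg i" if "x \<in> wspan X deg i" for m x
        using that unfolding wspan keys by blast
      ultimately show ?thesis by (simp add: graded_def)
    qed
    have "wsum deg' w = i \<longleftrightarrow> wsum deg w = i - s (wsum f w)" for w i
      unfolding wsum_eq[OF assms] by linarith
    then show "x \<in> wspan X deg' i \<longleftrightarrow> (\<forall>m. prj (wsum f) m x \<in> wspan X deg (i - s m))" for i x
      unfolding wspan keys subset_iff mem_Collect_eq by blast
  qed
qed

section \<open>The three complexes after the change of degrees\<close>

lemma regraded_sym_lams: "regraded_cplx (wsum (lams_wt \<mu>)) s (sym_lams \<delta> l d) (sym_lams \<delta>' l d)"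
proof
  show "regraded (wsum (lams_wt \<mu>)) s (gr (sym_lams \<delta> l d)) (gr (sym_lams \<delta>' l d))"
    unfolding sym_lams_def cplx.simps by (rule regraded_wspan) (rule lams_deg_eq)
qed (rule sym_lams_eq graded_sym_lams wt_map_sym_lams)+

text \<open>Covers both kinds of invariants: those of the Lie algebra, with \<open>h\<close> the
  coadjoint action, and those of the Weyl group, with \<open>h\<close> the action minus the
  identity. The invariance condition does not mention degrees, hence is a constant family.\<close>

lemma regraded_invariants:
  assumes "\<And>y. y \<in> Y \<Longrightarrow> wt_map (wsum (coef_wt \<mu>)) (wsum (coef_wt \<mu>)) (h y)"
  shows "regraded (wsum (coef_wt \<mu>)) s
    (\<lambda>i. {x \<in> wspan (coef_gens S) (coef_deg \<delta>) i. \<forall>y\<in>Y. h y x \<in> coef_null S \<delta>})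
    (\<lambda>i. {x \<in> wspan (coef_gens S) (coef_deg \<delta>') i. \<forall>y\<in>Y. h y x \<in> coef_null S \<delta>'})"
proof -
  let ?I = "\<Inter>y\<in>Y. h y -` coef_null S \<delta>"
  have y: "graded (wsum (coef_wt \<mu>)) (h y -` coef_null S \<delta>)" if "y \<in> Y" for y
    using assms[OF that] graded_coef_null by (rule graded_vimage)
  have "fv.subspace ?I" by (rule fv.subspace_Int) (use y in \<open>simp add: graded_def\<close>)
  then have "graded (wsum (coef_wt \<mu>)) ?I" using y by (simp add: graded_def)
  from regraded_Int[OF regraded_wspan[OF coef_deg_eq] regraded_const[OF this], of "coef_gens S"]
  have "regraded (wsum (coef_wt \<mu>)) s (\<lambda>i. wspan (coef_gens S) (coef_deg \<delta>) i \<inter> ?I)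
      (\<lambda>i. wspan (coef_gens S) (coef_deg \<delta>') i \<inter> ?I)" .
  moreover have "{x \<in> A. \<forall>y\<in>Y. h y x \<in> coef_null S \<delta>} = A \<inter> ?I" for A by auto
  ultimately show ?thesis by (simp add: coef_null_eq)
qed

lemma regraded_drep_inv:
  assumes "complex_lie_algebra scale B br"
  shows "regraded_cplx (wsum (coef_wt \<mu>)) s
    (complex_lie_algebra.drep_inv scale B br \<delta>) (complex_lie_algebra.drep_inv scale B br \<delta>')"
proof -
  interpret complex_lie_algebra scale B br by fact
  show ?thesis
  proof
    show "regraded (wsum (coef_wt \<mu>)) s (gr (drep_inv \<delta>)) (gr (drep_inv \<delta>'))"
      using regraded_invariants[where Y = UNIV and h = coad_action and S = B, OF wt_map_coad_action] by (simp add: drep_inv_def)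
    have "rep_diff \<delta>' = rep_diff \<delta>"
      unfolding rep_diff_def om_diff_eq by (intro arg_cong[of _ _ lin] der_parity) (simp_all add: parity)
    then show "bdry (drep_inv \<delta>') = bdry (drep_inv \<delta>)" by (simp add: drep_inv_def)
  qed (simp_all add: drep_inv_def coef_null_eq graded_coef_null wt_map_rep_diff)
qed

lemma regraded_hc_target:
  assumes "complex_lie_algebra scale B br"
  shows "regraded_cplx (wsum (coef_wt \<mu>)) s
    (complex_lie_algebra.hc_target scale br H HB \<delta>) (complex_lie_algebra.hc_target scale br H HB \<delta>')"
proof -
  interpret complex_lie_algebra scale B br by fact
  show ?thesis
  proof
    show "regraded (wsum (coef_wt \<mu>)) s (gr (hc_target H HB \<delta>)) (gr (hc_target H HB \<delta>'))"
      using regraded_invariants[where Y = "weyl_group H" and h = "\<lambda>\<omega> x. weyl_action HB \<omega> x - x" and S = HB,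
          OF wt_map_diff[OF wt_map_weyl_action wt_map_id]]
      by (simp add: hc_target_def)
  qed (simp_all add: hc_target_def coef_null_eq graded_coef_null wt_map_0)
qed

end

text \<open>Within one fixed weight m the regrading is a mere translation by \<open>s m\<close>; as
  this is even, each dimension keeps its sign and the sum is only reindexed.\<close>

lemma weighted_euler_regraded:
  fixes s :: "int \<times> int \<Rightarrow> int"
  assumes "regraded_cplx wt s M M'" and "\<And>m. even (s m)"
    and W: "\<And>m x. x \<in> W m \<Longrightarrow> homog wt m x"
  shows "weighted_euler M W = weighted_euler M' W"
proof
  interpret regraded_cplx wt s M M' by fact
  fix m
  have "x \<in> gr M' (i + s m) \<longleftrightarrow> x \<in> gr M i" if "x \<in> W m" for i x
  proof -
    have "prj wt n x = (if n = m then x else 0)" for n by (rule homog_prj) (rule W[OF that])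
    \<comment> \<open>For n other than m the component is 0, which lies in every degree; only n = m
      gives a condition.\<close>
    then have "prj wt n x \<in> gr M (i + s m - s n) \<longleftrightarrow> n = m \<longrightarrow> x \<in> gr M i" for n
      using gradedD(1)[OF regradedD(1)[OF gr]] by simp
    then show ?thesis unfolding regradedD(2)[OF gr, of x] by blast
  qed
  then have "gr M' (i + s m) \<inter> W m = gr M i \<inter> W m" for i by blast
  then have dim: "weight_dim M' W (i + s m) m = weight_dim M W i m" for i
    by (simp add: weight_dim_def null_eq)
  have dim': "weight_dim M' W j m = weight_dim M W (j - s m) m" for j
    using dim[of "j - s m"] by simp
  show "weighted_euler M W m = weighted_euler M' W m"
    unfolding weighted_euler_def
    by (rule sum.reindex_bij_witness[of _ "\<lambda>i. i - s m" "\<lambda>i. i + s m"])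
      (simp_all add: dim' assms(2))
qed

theorem proposition9p1:
  fixes scale :: "complex \<Rightarrow> 'g::ab_group_add \<Rightarrow> 'g"
    and B H HB :: "'g set"
    and br :: "'g \<Rightarrow> 'g \<Rightarrow> 'g"
    and l :: nat and d :: "nat \<Rightarrow> nat"
    and F :: "nat \<Rightarrow> 'g list \<Rightarrow> complex"
    and p r p' r' :: int
  assumes "reductive_lie_algebra scale B br"
    and "complex_lie_algebra.cartan_subalgebra scale br H"
    and "\<not> module.dependent scale HB" and "module.span scale HB = H"
    and "complex_lie_algebra.fundamental_invariants scale br l d F"
    and "even p \<longleftrightarrow> even p'" and "even r \<longleftrightarrow> even r'"
  shows
    "weighted_euler (complex_lie_algebra.drep_inv scale B br (uv_deg p r))
         (weight_space B uv_weight)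
       = weighted_euler (complex_lie_algebra.drep_inv scale B br (uv_deg p' r'))
         (weight_space B uv_weight) \<and>
     (quasi_iso (complex_lie_algebra.drep_inv scale B br (uv_deg p r))
         (complex_lie_algebra.hc_target scale br H HB (uv_deg p r))
         (complex_lie_algebra.hc_map scale B HB)
       \<longrightarrow> quasi_iso (complex_lie_algebra.drep_inv scale B br (uv_deg p' r'))
         (complex_lie_algebra.hc_target scale br H HB (uv_deg p' r'))
         (complex_lie_algebra.hc_map scale B HB)) \<and>
     (quasi_iso (sym_lams (uv_deg p r) l d)
         (complex_lie_algebra.drep_inv scale B br (uv_deg p r))
         (complex_lie_algebra.drinfeld_map scale B br F)
       \<longrightarrow> quasi_iso (sym_lams (uv_deg p' r') l d)
         (complex_lie_algebra.drep_inv scale B br (uv_deg p' r'))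
         (complex_lie_algebra.drinfeld_map scale B br F))"
proof -
  have lie: "complex_lie_algebra scale B br"
    using assms(1) by (simp add: reductive_lie_algebra_def)
  let ?s = "\<lambda>m :: int \<times> int. fst m * (p' - p) + snd m * (r' - r)"
  interpret regrading uv_weight ?s "uv_deg p r" "uv_deg p' r'"
  proof
    show "uv_deg p' r' x = uv_deg p r x + ?s (uv_weight x)" for x by (cases x) simp_all
  qed (use assms(6,7) in \<open>auto simp: algebra_simps\<close>)
  note D = regraded_drep_inv[OF lie]
  have W: "homog (wsum (coef_wt uv_weight)) m x" if "x \<in> weight_space B uv_weight m" for m x
    using keys_span_bas[OF that[unfolded weight_space_def]] by (auto simp: homog_def)
  show ?thesis
  proof (intro conjI impI)
    show "weighted_euler (complex_lie_algebra.drep_inv scale B br (uv_deg p r)) (weight_space B uv_weight)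
       = weighted_euler (complex_lie_algebra.drep_inv scale B br (uv_deg p' r')) (weight_space B uv_weight)"
      by (rule weighted_euler_regraded[OF D s_even W])
  next
    assume "quasi_iso (complex_lie_algebra.drep_inv scale B br (uv_deg p r))
      (complex_lie_algebra.hc_target scale br H HB (uv_deg p r)) (complex_lie_algebra.hc_map scale B HB)"
    then show "quasi_iso (complex_lie_algebra.drep_inv scale B br (uv_deg p' r'))
      (complex_lie_algebra.hc_target scale br H HB (uv_deg p' r')) (complex_lie_algebra.hc_map scale B HB)"
      by (rule quasi_iso_regraded[OF D regraded_hc_target[OF lie] complex_lie_algebra.wt_map_hc_map[OF lie]])
  next
    assume "quasi_iso (sym_lams (uv_deg p r) l d)
      (complex_lie_algebra.drep_inv scale B br (uv_deg p r)) (complex_lie_algebra.drinfeld_map scale B br F)"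
    then show "quasi_iso (sym_lams (uv_deg p' r') l d)
      (complex_lie_algebra.drep_inv scale B br (uv_deg p' r')) (complex_lie_algebra.drinfeld_map scale B br F)"
      by (rule quasi_iso_regraded[OF regraded_sym_lams D complex_lie_algebra.wt_map_drinfeld_map[OF lie]])
  qed
qed

end
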